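(* Assume: (A1) for every $(t,x)\in[0,T]\times X$ the set $f(t,x,U)=\{f(t,x,u):u\in U\}$ is convex; (A2) there exist $t_1\in[0,T]$ and an admissible control $u\in\mathcal{U}(0,t_1,x_0)$; (A3) there exists $T^\sharp\ge T$ such that the minimal time control problem defined over the horizon $[0,T^\sharp]$ has a value function $V^\sharp$ which takes finite values over $Y=[0,T]\times X$ and is Lipschitz continuous (on $Y$). Let $V\in C^1(\mathbb{R}^{n+1})$, and let $(x_V(\cdot),u_V(\cdot))$ be a closed-loop trajectory starting at $(0,x_0)$, satisfying the differential inclusion $\dot x_V(t)=f(t,x_V(t),u_V(t))$ with $u_V(t)\in\mathcal{U}_V(t,x_V(t))$ and the state constraints $x_V(t)\in X$ over $[0,T]$. Define $t_V=\sup\{t\in[0,T]: x_V([0,t])\subset X\setminus K\}$. Then $$V^\sharp(t,x_V(t))\le(\tau^*-t)+t\,2(1+C_f)\,\|\nabla V-\nabla V^\sharp\|_\infty\qquad\forall t\in[0,t_V],$$ where $\tau^*=V^*(0,x_0)=V^\sharp(0,x_0)\le t_V$. In particular, $$V^\sharp(\tau^*,x_V(\tau^* ))\le 2\tau^*(1+C_f)\,\|\nabla V-\nabla V^\sharp\|_\infty.$$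
   Context: Setting. Let $n,m\ge 1$ be integers, $T>0$, $f:\mathbb{R}\times\mathbb{R}^n\times\mathbb{R}^m\to\mathbb{R}^n$ Lipschitz continuous, $U\subset\mathbb{R}^m$ a nonempty compact set, $X\subset\mathbb{R}^n$ and $K\subset X$ compact sets, and $x_0\in X$. For $0\le t_0\le t_1$ and $\xi\in\mathbb{R}^n$, $\mathcal{U}(t_0,t_1,\xi)$ is the set of admissible controls: bounded measurable $u:[t_0,t_1]\to U$ such that the (absolutely continuous) solution of $\dot x(t)=f(t,x(t),u(t))$ with $x(t_0)=\xi$ is well defined on $[t_0,t_1]$, satisfies $x(t)\in X$ for a.e. $t\in[t_0,t_1]$, and $x(t_1)\in K$. The value functions of the minimal time problems over the horizons $[0,T]$ and $[0,T^\sharp]$ are $$V^*(t_0,\xi)=\inf\{t_1-t_0:t_1\in[t_0,T],\,u\in\mathcal{U}(t_0,t_1,\xi)\},\quad V^\sharp(t_0,\xi)=\inf\{t_1-t_0:t_1\in[t_0,T^\sharp],\,u\in\mathcal{U}(t_0,t_1,\xi)\},$$ with value $+\infty$ if there is no admissible control. Since $V^\sharp$ is Lipschitz on $Y=[0,T]\times X\subset\mathbb{R}^{n+1}$, it admits a Lipschitz extension to $\mathbb{R}^{n+1}$; such an extension is fixed and still denoted $V^\sharp$. $\partial^cV^\sharp(y)$ is the Clarke subdifferential at $y$ of this (extended) function. For $V\in C^1(\mathbb{R}^{n+1})$ (a function of $y=(t,x)$), $$\|\nabla V-\nabla V^\sharp\|_\infty=\sup_{y\in Y}\ \sup_{g\in\partial^cV^\sharp(y)}\|\nabla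 V(y)-g\|_2,\qquad C_f=\sup_{(t,x,u)\in Y\times U}\|f(t,x,u)\|,$$ $$\mathcal{U}_V(t,x)=\operatorname*{argmin}_{u\in U}\nabla_xV(t,x)^\top f(t,x,u).$$ In a closed-loop trajectory, $x_V(\cdot)$ is absolutely continuous, $u_V(\cdot)$ is measurable, and the inclusion holds for a.e. $t$. If the set defining $t_V$ is empty (i.e. $x_0\in K$), $t_V=0$ by convention. *)

theory Defs
  imports "HOL-Analysis.Analysis"
begin

definition abs_continuous_on :: "real \<Rightarrow> real \<Rightarrow> (real \<Rightarrow> 'a::real_normed_vector) \<Rightarrow> bool" where
  "abs_continuous_on a b x \<longleftrightarrow>
     (\<forall>\<epsilon>>0. \<exists>\<delta>>0. \<forall>\<D>. \<D> division_of \<Union>\<D> \<and> \<Union>\<D> \<subseteq> {a..b} \<and> (\<Sum>I\<in>\<D>. Sup I - Inf I) < \<delta>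
        \<longrightarrow> (\<Sum>I\<in>\<D>. norm (x (Sup I) - x (Inf I))) < \<epsilon>)"

text \<open>The data \<open>f\<close> takes its arguments as a triple \<open>(t, x, u)\<close>, so that a Lipschitz
  hypothesis on \<open>f\<close> refers to the Euclidean norm of the product space.\<close>

definition ode_solution ::
  "(real \<times> (real^'n) \<times> (real^'m) \<Rightarrow> real^'n) \<Rightarrow> real \<Rightarrow> real
     \<Rightarrow> (real \<Rightarrow> real^'m) \<Rightarrow> (real \<Rightarrow> real^'n) \<Rightarrow> bool" where
  "ode_solution f t0 t1 u x \<longleftrightarrow>
     abs_continuous_on t0 t1 x \<and>
     (AE t in lebesgue_on {t0..t1}.
        (x has_vector_derivative f (t, x t, u t)) (at t within {t0..t1}))"

text \<open>Controls and trajectories are total functions; only their values on \<open>{t0..t1}\<close> matter.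
  Since \<open>f\<close> is Lipschitz, there is at most one solution on \<open>{t0..t1}\<close>, so the existential
  quantifier speaks about \<^emph>\<open>the\<close> solution.\<close>

definition admissible_controls ::
  "(real \<times> (real^'n) \<times> (real^'m) \<Rightarrow> real^'n) \<Rightarrow> (real^'m) set \<Rightarrow> (real^'n) set \<Rightarrow> (real^'n) set
     \<Rightarrow> real \<Rightarrow> real \<Rightarrow> real^'n \<Rightarrow> (real \<Rightarrow> real^'m) set" where
  "admissible_controls f U X K t0 t1 \<xi> =
     {u. u \<in> borel_measurable (lebesgue_on {t0..t1}) \<and> bounded (u ` {t0..t1}) \<and>
         (\<forall>t\<in>{t0..t1}. u t \<in> U) \<and>
         (\<exists>x. ode_solution f t0 t1 u x \<and> x t0 = \<xi> \<and>
              (AE t in lebesgue_on {t0..t1}. x t \<in> X) \<and> x t1 \<in> K)}"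

text \<open>The infimum is taken in \<open>ereal\<close>, so it is \<open>\<infinity>\<close> if there is no admissible control.\<close>

definition min_time ::
  "(real \<times> (real^'n) \<times> (real^'m) \<Rightarrow> real^'n) \<Rightarrow> (real^'m) set \<Rightarrow> (real^'n) set \<Rightarrow> (real^'n) set
     \<Rightarrow> real \<Rightarrow> real \<times> (real^'n) \<Rightarrow> ereal" where
  "min_time f U X K T = (\<lambda>(t0, \<xi>).
     Inf {ereal (t1 - t0) |t1 u. t1 \<in> {t0..T} \<and> u \<in> admissible_controls f U X K t0 t1 \<xi>})"

text \<open>Clarke's generalized directional derivative, the upper limit of the difference quotient
  as \<open>z \<rightarrow> y\<close> and \<open>h \<down> 0\<close>, and the subdifferential it supports.\<close>

definition clarke_dderiv :: "('a::real_normed_vector \<Rightarrow> real) \<Rightarrow> 'a \<Rightarrow> 'a \<Rightarrow> ereal" where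
  "clarke_dderiv W y v =
     Limsup (nhds y \<times>\<^sub>F at_right 0) (\<lambda>(z, h). ereal ((W (z + h *\<^sub>R v) - W z) / h))"

definition clarke_subdiff :: "('a::real_inner \<Rightarrow> real) \<Rightarrow> 'a \<Rightarrow> 'a set" where
  "clarke_subdiff W y = {g. \<forall>v. ereal (g \<bullet> v) \<le> clarke_dderiv W y v}"

text \<open>Distance between a gradient field \<open>DV\<close> and the Clarke subdifferential of \<open>W\<close> over \<open>Y\<close>.
  The real-valued suprema are genuine ones when \<open>W\<close> is Lipschitz, \<open>DV\<close> is continuous and \<open>Y\<close> is
  nonempty and compact: all sets involved are then nonempty and bounded.\<close>

definition grad_dist :: "('a::real_inner) set \<Rightarrow> ('a \<Rightarrow> 'a) \<Rightarrow> ('a \<Rightarrow> real) \<Rightarrow> real" where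
  "grad_dist Y DV W = (SUP y\<in>Y. SUP g\<in>clarke_subdiff W y. norm (DV y - g))"

definition speed_bound ::
  "(real \<times> (real^'n) \<times> (real^'m) \<Rightarrow> real^'n) \<Rightarrow> (real^'m) set \<Rightarrow> (real^'n) set \<Rightarrow> real \<Rightarrow> real" where
  "speed_bound f U X T = (SUP p\<in>{0..T} \<times> X \<times> U. norm (f p))"

text \<open>In terms of the full gradient \<open>DV\<close> of a function of \<open>(t, x)\<close>, its partial gradient with
  respect to \<open>x\<close> is the second component.\<close>

definition feedback_set ::
  "(real \<times> (real^'n) \<times> (real^'m) \<Rightarrow> real^'n) \<Rightarrow> (real^'m) set
     \<Rightarrow> (real \<times> (real^'n) \<Rightarrow> real \<times> (real^'n)) \<Rightarrow> real \<Rightarrow> real^'n \<Rightarrow> (real^'m) set" where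
  "feedback_set f U DV t x = {u. is_arg_min (\<lambda>u. snd (DV (t, x)) \<bullet> f (t, x, u)) (\<lambda>u. u \<in> U) u}"

definition closed_loop_trajectory ::
  "(real \<times> (real^'n) \<times> (real^'m) \<Rightarrow> real^'n) \<Rightarrow> (real^'m) set \<Rightarrow> (real^'n) set
     \<Rightarrow> (real \<times> (real^'n) \<Rightarrow> real \<times> (real^'n)) \<Rightarrow> real \<Rightarrow> real^'n
     \<Rightarrow> (real \<Rightarrow> real^'n) \<Rightarrow> (real \<Rightarrow> real^'m) \<Rightarrow> bool" where
  "closed_loop_trajectory f U X DV T x0 x u \<longleftrightarrow>
     u \<in> borel_measurable (lebesgue_on {0..T}) \<and>
     ode_solution f 0 T u x \<and> x 0 = x0 \<and>
     (AE t in lebesgue_on {0..T}. u t \<in> feedback_set f U DV t (x t)) \<and>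
     (\<forall>t\<in>{0..T}. x t \<in> X)"

definition target_time ::
  "(real^'n) set \<Rightarrow> (real^'n) set \<Rightarrow> real \<Rightarrow> (real \<Rightarrow> real^'n) \<Rightarrow> real" where
  "target_time X K T x =
     (let S = {t\<in>{0..T}. x ` {0..t} \<subseteq> X - K} in if S = {} then 0 else Sup S)"

end

theory Submission
  imports Defs
begin

text \<open>Along the closed loop the function \<open>t \<mapsto> V\<^sup>\<sharp>(t, x\<^sub>V(t))\<close> is absolutely continuous, so it is
  enough to bound Clarke's derivative of \<open>V\<^sup>\<sharp>\<close> in the direction \<open>(1, f(t, x\<^sub>V, u\<^sub>V))\<close> almost everywhere
  before \<open>t\<^sub>V\<close>. Off the target, near-optimal controls and dynamic programming yield a velocity
  \<open>f(t, x, w)\<close> along which \<open>V\<^sup>\<sharp>\<close> decreases at unit rate (convexity of \<open>f(t, x, U)\<close> makes the limit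
  velocity attainable), hence a Clarke subgradient \<open>g\<close> with \<open>g \<bullet> (1, f(t, x, w)) \<le> -1\<close>. Replacing \<open>g\<close> by
  \<open>\<nabla>V\<close>, then \<open>w\<close> by the minimising feedback, then \<open>\<nabla>V\<close> by the subgradient realising Clarke's
  derivative costs at most \<open>(1 + C\<^sub>f) \<parallel>\<nabla>V - \<nabla>V\<^sup>\<sharp>\<parallel>\<close> twice. No optimal control is needed, and
  arguing with Clarke's derivative directly avoids a chain rule for \<open>V\<^sup>\<sharp>\<close>.\<close>

section \<open>Absolutely continuous functions\<close>

lemma AE_lebesgue_on_iff_negligible:
  assumes "S \<in> sets lebesgue"
  shows "(AE x in lebesgue_on S. P x) \<longleftrightarrow> negligible {x\<in>S. \<not> P x}"
proof -
  have "(AE x in lebesgue_on S. P x) \<longleftrightarrow> (AE x in lebesgue. x \<in> S \<longrightarrow> P x)"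
    using assms by (intro AE_restrict_space_iff) auto
  also have "\<dots> \<longleftrightarrow> negligible {x. \<not> (x \<in> S \<longrightarrow> P x)}"
    unfolding eventually_ae_filter_negligible using negligible_subset by blast
  also have "{x. \<not> (x \<in> S \<longrightarrow> P x)} = {x\<in>S. \<not> P x}" by blast
  finally show ?thesis .
qed

lemma AE_lebesgue_on_subset:
  assumes "AE x in lebesgue_on S. P x" "A \<subseteq> S" "S \<in> sets lebesgue" "A \<in> sets lebesgue"
    and "\<And>x. x \<in> A \<Longrightarrow> P x \<Longrightarrow> Q x"
  shows "AE x in lebesgue_on A. Q x"
  using assms by (auto simp: AE_lebesgue_on_iff_negligible elim!: negligible_subset)

lemma abs_continuous_on_subset:
  assumes "abs_continuous_on a b x" "a \<le> c" "d \<le> b"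
  shows "abs_continuous_on c d x"
  unfolding abs_continuous_on_def
proof (intro allI impI)
  fix \<epsilon> :: real assume "\<epsilon> > 0"
  then obtain \<delta> where "\<delta> > 0" and \<delta>: "\<And>\<D>. \<D> division_of \<Union>\<D> \<and> \<Union>\<D> \<subseteq> {a..b} \<and> (\<Sum>I\<in>\<D>. Sup I - Inf I) < \<delta>
        \<longrightarrow> (\<Sum>I\<in>\<D>. norm (x (Sup I) - x (Inf I))) < \<epsilon>"
    using assms(1) unfolding abs_continuous_on_def by meson
  have "{c..d} \<subseteq> {a..b}" using assms by auto
  then show "\<exists>\<delta>>0. \<forall>\<D>. \<D> division_of \<Union>\<D> \<and> \<Union>\<D> \<subseteq> {c..d} \<and> (\<Sum>I\<in>\<D>. Sup I - Inf I) < \<delta>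
        \<longrightarrow> (\<Sum>I\<in>\<D>. norm (x (Sup I) - x (Inf I))) < \<epsilon>"
    using \<open>\<delta> > 0\<close> \<delta> by (intro exI[of _ \<delta>]) (simp add: subset_trans[of _ "{c..d}" "{a..b}"])
qed

lemma division_of_real_element:
  fixes \<D> :: "real set set"
  assumes "\<D> division_of S" "I \<in> \<D>"
  obtains u v where "u \<le> v" "I = {u..v}" "Sup I = v" "Inf I = u" "u \<in> S" "v \<in> S"
proof -
  obtain u v where "I = cbox u v" "I \<noteq> {}" "I \<subseteq> S"
    using division_ofD[OF assms(1)] assms(2) by metis
  then have uv: "u \<le> v" "I = {u..v}" by auto
  then have "u \<in> S" "v \<in> S" using \<open>I \<subseteq> S\<close> by auto
  then show ?thesis using uv by (intro that[of u v]) auto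
qed

text \<open>An increment of the composite over an interval is at most \<open>L\<close> times the sum
  of the length and the increment of \<open>x\<close>, so a small total length controls both
  contributions.\<close>

lemma abs_continuous_on_compose_lipschitz:
  fixes W :: "real \<times> 'a::real_normed_vector \<Rightarrow> 'b::real_normed_vector"
  assumes x: "abs_continuous_on a b x" and W: "L-lipschitz_on UNIV W"
  shows "abs_continuous_on a b (\<lambda>s. W (s, x s))"
  unfolding abs_continuous_on_def
proof (intro allI impI)
  fix \<epsilon> :: real assume "\<epsilon> > 0"
  have L: "L \<ge> 0" using W lipschitz_on_nonneg by blast
  \<comment> \<open>Lengths and increments of \<open>x\<close> each contribute at most
    \<open>L * e\<close>. Taking \<open>L + 1\<close> makes the final inequality strict and keeps
    the divisor nonzero when \<open>L = 0\<close>.\<close>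
  define e where "e = \<epsilon> / (2 * (L + 1))"
  have "e > 0" using \<open>\<epsilon> > 0\<close> L by (simp add: e_def)
  then obtain \<delta> where "\<delta> > 0" and \<delta>: "\<And>\<D>. \<D> division_of \<Union>\<D> \<and> \<Union>\<D> \<subseteq> {a..b} \<and> (\<Sum>I\<in>\<D>. Sup I - Inf I) < \<delta>
        \<longrightarrow> (\<Sum>I\<in>\<D>. norm (x (Sup I) - x (Inf I))) < e"
    using x unfolding abs_continuous_on_def by meson
  show "\<exists>\<delta>>0. \<forall>\<D>. \<D> division_of \<Union>\<D> \<and> \<Union>\<D> \<subseteq> {a..b} \<and> (\<Sum>I\<in>\<D>. Sup I - Inf I) < \<delta>
        \<longrightarrow> (\<Sum>I\<in>\<D>. norm (W (Sup I, x (Sup I)) - W (Inf I, x (Inf I)))) < \<epsilon>"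
  proof (intro exI[of _ "min \<delta> e"] conjI allI impI)
    show "min \<delta> e > 0" using \<open>\<delta> > 0\<close> \<open>e > 0\<close> by simp
    fix \<D> :: "real set set"
    assume D: "\<D> division_of \<Union>\<D> \<and> \<Union>\<D> \<subseteq> {a..b} \<and> (\<Sum>I\<in>\<D>. Sup I - Inf I) < min \<delta> e"
    have "norm (W (Sup I, x (Sup I)) - W (Inf I, x (Inf I)))
        \<le> L * ((Sup I - Inf I) + norm (x (Sup I) - x (Inf I)))" if I: "I \<in> \<D>" for I
    proof -
      obtain u v where "u \<le> v" "Sup I = v" "Inf I = u"
        using division_of_real_element[of \<D> "\<Union>\<D>" I] D I by metis
      have "norm (W (Sup I, x (Sup I)) - W (Inf I, x (Inf I)))
          \<le> L * norm ((Sup I, x (Sup I)) - (Inf I, x (Inf I)))"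
        using lipschitz_onD[OF W, of "(Sup I, x (Sup I))" "(Inf I, x (Inf I))"] by (simp add: dist_norm)
      also have "norm ((Sup I, x (Sup I)) - (Inf I, x (Inf I))) \<le> (Sup I - Inf I) + norm (x (Sup I) - x (Inf I))"
        using norm_Pair_le[of "Sup I - Inf I" "x (Sup I) - x (Inf I)"] \<open>u \<le> v\<close> \<open>Sup I = v\<close> \<open>Inf I = u\<close> by simp
      finally show ?thesis using L by (simp add: mult_left_mono)
    qed
    then have "(\<Sum>I\<in>\<D>. norm (W (Sup I, x (Sup I)) - W (Inf I, x (Inf I))))
       \<le> (\<Sum>I\<in>\<D>. L * ((Sup I - Inf I) + norm (x (Sup I) - x (Inf I))))"
      by (intro sum_mono)
    also have "(\<Sum>I\<in>\<D>. L * ((Sup I - Inf I) + norm (x (Sup I) - x (Inf I))))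
       = L * (\<Sum>I\<in>\<D>. (Sup I - Inf I) + norm (x (Sup I) - x (Inf I)))"
      by (rule sum_distrib_left[symmetric])
    also have "(\<Sum>I\<in>\<D>. (Sup I - Inf I) + norm (x (Sup I) - x (Inf I)))
       = (\<Sum>I\<in>\<D>. Sup I - Inf I) + (\<Sum>I\<in>\<D>. norm (x (Sup I) - x (Inf I)))"
      by (rule sum.distrib)
    also have "L * ((\<Sum>I\<in>\<D>. Sup I - Inf I) + (\<Sum>I\<in>\<D>. norm (x (Sup I) - x (Inf I)))) \<le> L * (e + e)"
      using D \<delta>[of \<D>] L by (intro mult_left_mono add_mono) (auto intro: less_imp_le)
    also have "\<dots> < 2 * (L + 1) * e" using \<open>e > 0\<close> by (simp add: algebra_simps)
    also have "\<dots> = \<epsilon>" using L by (simp add: e_def)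
    finally show "(\<Sum>I\<in>\<D>. norm (W (Sup I, x (Sup I)) - W (Inf I, x (Inf I)))) < \<epsilon>" .
  qed
qed

lemma abs_continuous_on_compose_lipschitz':
  assumes x: "abs_continuous_on a b x" and W: "L-lipschitz_on UNIV W"
  shows "abs_continuous_on a b (\<lambda>s. W (x s))"
proof -
  have "L-lipschitz_on UNIV (\<lambda>y::real \<times> 'a. W (snd y))"
  proof (rule lipschitz_onI)
    fix y z :: "real \<times> 'a"
    have "dist (W (snd y)) (W (snd z)) \<le> L * dist (snd y) (snd z)" using lipschitz_onD[OF W] by simp
    also have "\<dots> \<le> L * dist y z" using lipschitz_on_nonneg[OF W] by (intro mult_left_mono dist_snd_le)
    finally show "dist (W (snd y)) (W (snd z)) \<le> L * dist y z" .
  qed (rule lipschitz_on_nonneg[OF W])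
  from abs_continuous_on_compose_lipschitz[OF x this] show ?thesis by simp
qed

lemma abs_continuous_on_imp_continuous_on:
  assumes "abs_continuous_on a b x"
  shows "continuous_on {a..b} x"
proof (rule continuous_onI)
  fix s e :: real assume s: "s \<in> {a..b}" and "e > 0"
  obtain \<delta> where "\<delta> > 0" and \<delta>: "\<And>\<D>. \<D> division_of \<Union>\<D> \<and> \<Union>\<D> \<subseteq> {a..b} \<and> (\<Sum>I\<in>\<D>. Sup I - Inf I) < \<delta>
        \<longrightarrow> (\<Sum>I\<in>\<D>. norm (x (Sup I) - x (Inf I))) < e"
    using assms \<open>e > 0\<close> unfolding abs_continuous_on_def by meson
  have *: "dist (x v) (x u) < e" if "u \<le> v" "u \<in> {a..b}" "v \<in> {a..b}" "v - u < \<delta>" for u v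
    using \<delta>[of "{{u..v}}"] that division_of_self[of u v] by (auto simp: dist_norm)
  show "\<exists>d>0. \<forall>s'\<in>{a..b}. dist s' s < d \<longrightarrow> dist (x s') (x s) \<le> e"
  proof (intro exI[of _ \<delta>] conjI ballI impI)
    fix s' assume "s' \<in> {a..b}" "dist s' s < \<delta>"
    then show "dist (x s') (x s) \<le> e"
      using *[of s s'] *[of s' s] s by (cases "s \<le> s'") (auto simp: dist_real_def dist_commute less_imp_le)
  qed fact
qed

text \<open>The hypothesis controls increments over intervals straddling the point; the exceptional
  null set is absorbed by absolute continuity, via a fine tagged division.\<close>

lemma abs_continuous_growth:
  fixes \<phi> :: "real \<Rightarrow> real"
  assumes ab: "a \<le> b" and ac: "abs_continuous_on a b \<phi>" and N: "negligible N"
    and straddle: "\<And>s \<epsilon>. \<lbrakk>s \<in> {a..b} - N; \<epsilon> > 0\<rbrakk> \<Longrightarrow> \<exists>d>0. \<forall>u v. a \<le> u \<and> s - d < u \<and> u \<le> s \<and> s \<le> v \<and> v < s + d \<and> v \<le> b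
            \<longrightarrow> \<phi> v - \<phi> u \<le> (c + \<epsilon>) * (v - u)"
  shows "\<phi> b - \<phi> a \<le> c * (b - a)"
proof -
  \<comment> \<open>The last two terms pay for the intervals tagged in \<open>N\<close>:
    \<open>\<epsilon>\<close> for the increments of \<open>\<phi>\<close>, the product for the
    increments of the linear function \<open>(c + \<epsilon>) * s\<close>.\<close>
  have main: "\<phi> b - \<phi> a \<le> (c + \<epsilon>) * (b - a) + \<epsilon> + (\<bar>c\<bar> + \<epsilon>) * \<epsilon>" if "\<epsilon> > 0" for \<epsilon>
  proof -
    obtain \<delta> where "\<delta> > 0" and \<delta>: "\<And>\<D>. \<D> division_of \<Union>\<D> \<and> \<Union>\<D> \<subseteq> {a..b} \<and> (\<Sum>I\<in>\<D>. Sup I - Inf I) < \<delta>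
        \<longrightarrow> (\<Sum>I\<in>\<D>. norm (\<phi> (Sup I) - \<phi> (Inf I))) < \<epsilon>"
      using ac \<open>\<epsilon> > 0\<close> unfolding abs_continuous_on_def by meson
    have "N \<in> sets lebesgue" using N by (simp add: negligible_imp_sets)
    \<comment> \<open>Since \<open>N\<close> is null, \<open>Ou\<close> itself has measure below
      \<open>\<delta>\<close>, which lets absolute continuity act, and below
      \<open>\<epsilon>\<close>, which bounds the total length.\<close>
    then obtain Ou where Ou: "open Ou" "N \<subseteq> Ou" "Ou - N \<in> lmeasurable" "emeasure lebesgue (Ou - N) < ennreal (min \<delta> \<epsilon>)"
      using sets_lebesgue_outer_open[of N "min \<delta> \<epsilon>"] \<open>\<delta> > 0\<close> \<open>\<epsilon> > 0\<close> by auto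
    have OuN: "Ou = (Ou - N) \<union> N" using Ou by auto
    have Oum: "Ou \<in> lmeasurable"
      by (subst OuN) (intro fmeasurable.Un Ou negligible_imp_measurable N)
    have "measure lebesgue (Ou - N) < min \<delta> \<epsilon>"
      using Ou(3,4) \<open>\<delta> > 0\<close> \<open>\<epsilon> > 0\<close> by (simp add: emeasure_eq_measure2 ennreal_less_iff)
    moreover have "measure lebesgue Ou = measure lebesgue (Ou - N)"
      using N Oum by (intro measure_Diff_null_set[symmetric]) (auto simp: negligible_iff_null_sets)
    ultimately have mO: "measure lebesgue Ou < min \<delta> \<epsilon>" by simp
    have "\<exists>d>0. s \<in> {a..b} - N \<longrightarrow> (\<forall>u v. a \<le> u \<and> s - d < u \<and> u \<le> s \<and> s \<le> v \<and> v < s + d \<and> v \<le> b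
            \<longrightarrow> \<phi> v - \<phi> u \<le> (c + \<epsilon>) * (v - u))" for s
      using straddle[OF _ \<open>\<epsilon> > 0\<close>, of s] by (cases "s \<in> {a..b} - N") (auto intro: exI[of _ 1])
    then obtain d where d0: "\<And>s. d s > 0" and d: "\<And>s u v. \<lbrakk>s \<in> {a..b} - N; a \<le> u; s - d s < u; u \<le> s; s \<le> v; v < s + d s; v \<le> b\<rbrakk>
            \<Longrightarrow> \<phi> v - \<phi> u \<le> (c + \<epsilon>) * (v - u)"
      by metis
    \<comment> \<open>Intervals tagged in \<open>N\<close> are forced into \<open>Ou\<close>, so
      their total length is small; at every other tag the gauge makes the straddling estimate
      available.\<close>
    define g where "g s = (if s \<in> N then Ou else ball s (d s))" for s
    have "gauge g" using Ou d0 by (auto simp: gauge_def g_def)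
    then obtain p where p: "p tagged_division_of {a..b}" "g fine p"
      using fine_division_exists_real by blast
    have finp: "finite p" using p(1) by auto
    define q where "q = {(s,I). (s,I) \<in> p \<and> s \<in> N}"
    have "q \<subseteq> p" by (auto simp: q_def)
    have qpart: "q tagged_partial_division_of {a..b}"
      using p(1) \<open>q \<subseteq> p\<close> tagged_partial_division_subset tagged_division_of_def by metis
    have q: "q tagged_division_of \<Union>(snd ` q)"
      by (rule tagged_partial_division_of_Union_self[OF qpart])
    have divq: "snd ` q division_of \<Union>(snd ` q)"
      by (rule division_of_tagged_division[OF q])
    have Uq: "\<Union>(snd ` q) \<subseteq> {a..b}"
      using tagged_partial_division_ofD(3)[OF qpart] by force
    have UqO: "\<Union>(snd ` q) \<subseteq> Ou"
      using p(2) by (force simp: q_def fine_def g_def)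
    have elem: "\<exists>u v. u \<le> s \<and> s \<le> v \<and> I = {u..v} \<and> Sup I = v \<and> Inf I = u \<and> a \<le> u \<and> v \<le> b" if sI: "(s, I) \<in> p" for s I
    proof -
      obtain u v where "I = cbox u v"
        using tagged_division_ofD(4)[OF p(1) sI] by blast
      moreover have "s \<in> I" "I \<subseteq> {a..b}"
        using tagged_division_ofD(2,3)[OF p(1) sI] by auto
      ultimately have "I = {u..v}" "s \<in> {u..v}" "{u..v} \<subseteq> {a..b}" by auto
      then show ?thesis by (intro exI[of _ u] exI[of _ v]) (auto simp: subset_iff)
    qed
    have qelem: "I \<noteq> {}" "Sup I - Inf I = measure lebesgue I" if "I \<in> snd ` q" for I
    proof -
      have "\<exists>s. (s, I) \<in> p" using that \<open>q \<subseteq> p\<close> by auto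
      then obtain s where s: "(s, I) \<in> p" ..
      obtain u v where "u \<le> s" "s \<le> v" "I = {u..v}" using elem[OF s] by blast
      then show "I \<noteq> {}" "Sup I - Inf I = measure lebesgue I" by simp_all
    qed
    have reindex: "(\<Sum>(s,I)\<in>q. h I) = sum h (snd ` q)"
      if "\<And>s. h {s} = 0" for h :: "real set \<Rightarrow> real"
    proof -
      \<comment> \<open>\<open>h\<close> is only known to vanish on singletons, while the reindexing
        rule asks for zero on every box with empty interior, the empty one included. Elements of
        \<open>q\<close> are nonempty, so \<open>?h\<close> agrees with \<open>h\<close> on
        them.\<close>
      let ?h = "\<lambda>I. if I = {} then 0 else h I"
      have "(\<Sum>(s,I)\<in>q. h I) = (\<Sum>(s,I)\<in>q. ?h I)"
        using qelem(1) by (intro sum.cong) force+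
      also have "\<dots> = sum ?h (snd ` q)"
      proof (rule sum.over_tagged_division_lemma[OF q])
        fix u v :: real assume "box u v = {}"
        then have "cbox u v = {} \<or> cbox u v = {u}" by auto
        then show "?h (cbox u v) = 0" using that by auto
      qed
      also have "\<dots> = sum h (snd ` q)"
        using qelem(1) by (intro sum.cong) simp_all
      finally show ?thesis .
    qed
    have len: "(\<Sum>I\<in>snd ` q. Sup I - Inf I) < min \<delta> \<epsilon>"
    proof -
      have "(\<Sum>I\<in>snd ` q. Sup I - Inf I) = (\<Sum>I\<in>snd ` q. measure lebesgue I)"
        using qelem(2) by (intro sum.cong) simp_all
      also have "\<dots> = measure lebesgue (\<Union>(snd ` q))"
        by (rule content_division[OF divq])
      also have "\<dots> \<le> measure lebesgue Ou"
        using lmeasurable_division[OF divq] Oum UqO by (intro measure_mono_fmeasurable) auto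
      finally show ?thesis using mO by simp
    qed
    have sum1: "(\<Sum>(s,I)\<in>q. \<bar>\<phi> (Sup I) - \<phi> (Inf I)\<bar>) < \<epsilon>"
      using \<delta>[of "snd ` q"] divq Uq len by (subst reindex) auto
    have sum2: "(\<Sum>(s,I)\<in>q. Sup I - Inf I) < \<epsilon>"
      using len by (subst reindex) auto
    have bound: "\<phi> (Sup I) - \<phi> (Inf I) - (c + \<epsilon>) * (Sup I - Inf I)
        \<le> (if (s, I) \<in> q then \<bar>\<phi> (Sup I) - \<phi> (Inf I)\<bar> + (\<bar>c\<bar> + \<epsilon>) * (Sup I - Inf I) else 0)"
      if sI: "(s, I) \<in> p" for s I
    proof -
      obtain u v where uv: "u \<le> s" "s \<le> v" "I = {u..v}" "Sup I = v" "Inf I = u" "a \<le> u" "v \<le> b"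
        using elem[OF sI] by blast
      show ?thesis
      proof (cases "s \<in> N")
        case True
        have "- (c + \<epsilon>) * (v - u) \<le> (\<bar>c\<bar> + \<epsilon>) * (v - u)"
          using uv \<open>\<epsilon> > 0\<close> by (intro mult_right_mono) auto
        then have "\<phi> v - \<phi> u - (c + \<epsilon>) * (v - u) \<le> \<bar>\<phi> v - \<phi> u\<bar> + (\<bar>c\<bar> + \<epsilon>) * (v - u)"
          unfolding minus_mult_left[symmetric] by linarith
        then show ?thesis using True sI uv by (auto simp: q_def)
      next
        case False
        have "I \<subseteq> ball s (d s)"
          using fineD[OF p(2) sI] False by (simp add: g_def)
        moreover have "u \<in> I" "v \<in> I" using uv by auto
        ultimately have "u \<in> ball s (d s)" "v \<in> ball s (d s)" by auto
        then have "\<phi> v - \<phi> u \<le> (c + \<epsilon>) * (v - u)"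
          using uv False by (intro d) (auto simp: dist_real_def)
        then show ?thesis using False uv by (auto simp: q_def)
      qed
    qed
    \<comment> \<open>The function \<open>\<phi> s - (c + \<epsilon>) * s\<close> telescopes over
      the tagged division.\<close>
    have "\<phi> b - \<phi> a - (c + \<epsilon>) * (b - a)
        = (\<Sum>(s,I)\<in>p. \<phi> (Sup I) - \<phi> (Inf I) - (c + \<epsilon>) * (Sup I - Inf I))"
      using additive_tagged_division_1[OF ab p(1), of "\<lambda>s. \<phi> s - (c + \<epsilon>) * s"]
      by (simp add: algebra_simps)
    also have "\<dots> \<le> (\<Sum>(s,I)\<in>p. if (s,I) \<in> q then \<bar>\<phi> (Sup I) - \<phi> (Inf I)\<bar> + (\<bar>c\<bar> + \<epsilon>) * (Sup I - Inf I) else 0)"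
      using bound by (intro sum_mono) auto
    also have "\<dots> = (\<Sum>(s,I)\<in>q. \<bar>\<phi> (Sup I) - \<phi> (Inf I)\<bar> + (\<bar>c\<bar> + \<epsilon>) * (Sup I - Inf I))"
      using finp \<open>q \<subseteq> p\<close> by (intro sum.mono_neutral_cong_right) auto
    also have "\<dots> = (\<Sum>(s,I)\<in>q. \<bar>\<phi> (Sup I) - \<phi> (Inf I)\<bar>) + (\<bar>c\<bar> + \<epsilon>) * (\<Sum>(s,I)\<in>q. Sup I - Inf I)"
      by (simp add: sum.distrib sum_distrib_left case_prod_beta)
    also have "\<dots> \<le> \<epsilon> + (\<bar>c\<bar> + \<epsilon>) * \<epsilon>"
      using sum1 sum2 \<open>\<epsilon> > 0\<close> by (intro add_mono mult_left_mono) auto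
    finally show ?thesis by simp
  qed
  have lim: "((\<lambda>\<epsilon>. (c + \<epsilon>) * (b - a) + \<epsilon> + (\<bar>c\<bar> + \<epsilon>) * \<epsilon>) \<longlongrightarrow> (c + 0) * (b - a) + 0 + (\<bar>c\<bar> + 0) * 0) (at_right 0)"
    by (intro tendsto_intros)
  have "\<forall>\<^sub>F \<epsilon> in at_right 0. \<phi> b - \<phi> a \<le> (c + \<epsilon>) * (b - a) + \<epsilon> + (\<bar>c\<bar> + \<epsilon>) * \<epsilon>"
    by (rule eventually_mono[OF eventually_at_right_less]) (rule main)
  from tendsto_lowerbound[OF lim this] have "\<phi> b - \<phi> a \<le> (c + 0) * (b - a) + 0 + (\<bar>c\<bar> + 0) * 0"
    by simp
  then show ?thesis by simp
qed

text \<open>Both endpoints are compared with the tangent at \<open>s\<close>; as \<open>s\<close>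
  lies between \<open>u\<close> and \<open>v\<close>, the two errors add up to a multiple of
  \<open>v - u\<close>. This is the shape of hypothesis that the growth estimate asks for.\<close>

lemma has_vector_derivative_straddle:
  fixes x :: "real \<Rightarrow> 'a::real_normed_vector"
  assumes "(x has_vector_derivative D) (at s within {a..b})" "\<epsilon> > 0"
  shows "\<exists>d>0. \<forall>u v. a \<le> u \<and> s - d < u \<and> u \<le> s \<and> s \<le> v \<and> v < s + d \<and> v \<le> b
            \<longrightarrow> norm (x v - x u - (v - u) *\<^sub>R D) \<le> \<epsilon> * (v - u)"
proof -
  obtain d where "d > 0" and d: "\<And>y. \<lbrakk>y \<in> {a..b}; norm (y - s) < d\<rbrakk> \<Longrightarrow> norm (x y - x s - (y - s) *\<^sub>R D) \<le> \<epsilon> * norm (y - s)"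
    using assms unfolding has_vector_derivative_def has_derivative_within_alt by blast
  have "norm (x v - x u - (v - u) *\<^sub>R D) \<le> \<epsilon> * (v - u)"
    if "a \<le> u" "s - d < u" "u \<le> s" "s \<le> v" "v < s + d" "v \<le> b" for u v
  proof -
    have "x v - x u - (v - u) *\<^sub>R D = (x v - x s - (v - s) *\<^sub>R D) - (x u - x s - (u - s) *\<^sub>R D)"
      by (simp add: algebra_simps)
    then have "norm (x v - x u - (v - u) *\<^sub>R D) \<le> norm (x v - x s - (v - s) *\<^sub>R D) + norm (x u - x s - (u - s) *\<^sub>R D)"
      by (metis norm_triangle_ineq4)
    also have "\<dots> \<le> \<epsilon> * norm (v - s) + \<epsilon> * norm (u - s)"
      using that by (intro add_mono d) auto
    also have "\<dots> = \<epsilon> * (v - u)" using that by (simp add: algebra_simps)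
    finally show ?thesis .
  qed
  then show ?thesis using \<open>d > 0\<close> by blast
qed

text \<open>Stands in for integrating the derivative: the scalar function
  \<open>w \<bullet> x\<close> stays absolutely continuous and inherits a straddling bound from the
  differentiability of \<open>x\<close>.\<close>

lemma abs_continuous_inner_growth:
  fixes x :: "real \<Rightarrow> 'a::real_inner"
  assumes ab: "a \<le> b" and ac: "abs_continuous_on a b x"
    and ae: "AE s in lebesgue_on {a..b}. \<exists>D. (x has_vector_derivative D) (at s within {a..b}) \<and> w \<bullet> D \<le> c"
  shows "w \<bullet> (x b - x a) \<le> c * (b - a)"
proof -
  let ?N = "{s\<in>{a..b}. \<not> (\<exists>D. (x has_vector_derivative D) (at s within {a..b}) \<and> w \<bullet> D \<le> c)}"
  have N: "negligible ?N" using ae by (simp add: AE_lebesgue_on_iff_negligible)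
  have lip: "(norm w)-lipschitz_on UNIV (\<lambda>v. w \<bullet> v)"
    by (rule lipschitz_onI) (auto simp: dist_norm Cauchy_Schwarz_ineq2 simp flip: inner_diff_right)
  have "w \<bullet> x b - w \<bullet> x a \<le> c * (b - a)"
  proof (rule abs_continuous_growth[OF ab abs_continuous_on_compose_lipschitz'[OF ac lip] N])
    fix s \<epsilon> :: real assume s: "s \<in> {a..b} - ?N" and "\<epsilon> > 0"
    then obtain D where D: "(x has_vector_derivative D) (at s within {a..b})" "w \<bullet> D \<le> c" by auto
    \<comment> \<open>The tangent error is later multiplied by \<open>norm w\<close>; adding 1
      covers \<open>w = 0\<close>.\<close>
    have "\<epsilon> / (norm w + 1) > 0" using \<open>\<epsilon> > 0\<close> by (simp add: add_nonneg_pos)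
    from has_vector_derivative_straddle[OF D(1) this] obtain d where "d > 0" and
      d: "\<And>u v. \<lbrakk>a \<le> u; s - d < u; u \<le> s; s \<le> v; v < s + d; v \<le> b\<rbrakk>
            \<Longrightarrow> norm (x v - x u - (v - u) *\<^sub>R D) \<le> \<epsilon> / (norm w + 1) * (v - u)" by metis
    have "w \<bullet> x v - w \<bullet> x u \<le> (c + \<epsilon>) * (v - u)"
      if "a \<le> u" "s - d < u" "u \<le> s" "s \<le> v" "v < s + d" "v \<le> b" for u v
    proof -
      have "w \<bullet> x v - w \<bullet> x u = w \<bullet> (x v - x u - (v - u) *\<^sub>R D) + (v - u) * (w \<bullet> D)"
        by (simp add: algebra_simps)
      also have "\<dots> \<le> norm w * (\<epsilon> / (norm w + 1) * (v - u)) + (v - u) * c"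
      proof (rule add_mono)
        show "w \<bullet> (x v - x u - (v - u) *\<^sub>R D) \<le> norm w * (\<epsilon> / (norm w + 1) * (v - u))"
          by (rule order_trans[OF norm_cauchy_schwarz mult_left_mono[OF d[OF that]]]) simp
        show "(v - u) * (w \<bullet> D) \<le> (v - u) * c"
          using that D(2) by (intro mult_left_mono) auto
      qed
      also have "\<dots> \<le> \<epsilon> * (v - u) + (v - u) * c"
      proof -
        have "norm w * (\<epsilon> / (norm w + 1)) \<le> \<epsilon>"
          using \<open>\<epsilon> > 0\<close> mult_left_mono[of "norm w" "norm w + 1" \<epsilon>]
          by (simp add: pos_divide_le_eq add_nonneg_pos mult.commute)
        then have "norm w * (\<epsilon> / (norm w + 1)) * (v - u) \<le> \<epsilon> * (v - u)"
          using that by (intro mult_right_mono) auto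
        then show ?thesis by (simp add: mult.assoc)
      qed
      finally show ?thesis by (simp add: algebra_simps)
    qed
    then show "\<exists>d>0. \<forall>u v. a \<le> u \<and> s - d < u \<and> u \<le> s \<and> s \<le> v \<and> v < s + d \<and> v \<le> b
            \<longrightarrow> w \<bullet> x v - w \<bullet> x u \<le> (c + \<epsilon>) * (v - u)" using \<open>d > 0\<close> by blast
  qed
  then show ?thesis by (simp add: inner_diff_right)
qed

text \<open>The scalar estimate is tested with the total increment itself, and one factor of its
  norm cancels.\<close>

lemma abs_continuous_norm_growth:
  fixes x :: "real \<Rightarrow> 'a::real_inner"
  assumes ab: "a \<le> b" and ac: "abs_continuous_on a b x"
    and ae: "AE s in lebesgue_on {a..b}. \<exists>D. (x has_vector_derivative D) (at s within {a..b}) \<and> norm D \<le> c"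
  shows "norm (x b - x a) \<le> c * (b - a)"
proof (cases "x b = x a")
  case False
  let ?w = "x b - x a"
  have "?w \<bullet> (x b - x a) \<le> (norm ?w * c) * (b - a)"
  proof (rule abs_continuous_inner_growth[OF ab ac AE_lebesgue_on_subset[OF ae]])
    fix s assume "\<exists>D. (x has_vector_derivative D) (at s within {a..b}) \<and> norm D \<le> c"
    then show "\<exists>D. (x has_vector_derivative D) (at s within {a..b}) \<and> ?w \<bullet> D \<le> norm ?w * c"
      by (meson mult_left_mono norm_cauchy_schwarz norm_ge_zero order_trans)
  qed auto
  then have "norm ?w * norm ?w \<le> norm ?w * (c * (b - a))"
    by (simp add: power2_norm_eq_inner[symmetric] power2_eq_square mult.assoc)
  then show ?thesis using False by simp
next
  case True
  \<comment> \<open>With equal end values there is nothing to cancel. If \<open>a < b\<close>, the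
    interval is not null, so the derivative bound holds at some point and forces \<open>c\<close> to
    be nonnegative.\<close>
  have "c * (b - a) \<ge> 0"
  proof (cases "a < b")
    case True
    have "\<not> negligible {a..b}" using True negligible_interval(1)[of a b] by (auto simp: box_real)
    moreover have "negligible {s\<in>{a..b}. \<not> (\<exists>D. (x has_vector_derivative D) (at s within {a..b}) \<and> norm D \<le> c)}"
      using ae by (simp add: AE_lebesgue_on_iff_negligible)
    ultimately have "\<not> {a..b} \<subseteq> {s\<in>{a..b}. \<not> (\<exists>D. (x has_vector_derivative D) (at s within {a..b}) \<and> norm D \<le> c)}"
      using negligible_subset by blast
    then obtain D where "norm (D::'a) \<le> c" by blast
    then have "0 \<le> c" using norm_ge_zero order_trans by blast
    then show ?thesis using ab by simp
  qed (use ab in auto)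
  then show ?thesis using True by simp
qed

section \<open>Clarke subdifferentials\<close>

text \<open>The upper limit along the product filter in \<epsilon>-\<delta> form, with one radius
  for base points and steps and the quotient cleared. All later estimates of Clarke's derivative go
  through this form.\<close>

lemma clarke_dderiv_le_iff:
  fixes W :: "'a::real_normed_vector \<Rightarrow> real"
  shows "clarke_dderiv W y v \<le> ereal c \<longleftrightarrow>
    (\<forall>\<epsilon>>0. \<exists>d>0. \<forall>z h. dist z y < d \<and> 0 < h \<and> h < d \<longrightarrow> W (z + h *\<^sub>R v) - W z \<le> (c + \<epsilon>) * h)"
    (is "?L \<longleftrightarrow> ?R")
proof
  assume L: ?L
  show ?R
  proof (intro allI impI)
    fix \<epsilon> :: real assume "\<epsilon> > 0"
    then have "Limsup (nhds y \<times>\<^sub>F at_right 0) (\<lambda>(z, h). ereal ((W (z + h *\<^sub>R v) - W z) / h)) < ereal (c + \<epsilon>)"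
      using L unfolding clarke_dderiv_def by (simp add: order.strict_trans1)
    from Limsup_lessD[OF this]
    obtain P Q where P: "eventually P (nhds y)" and Q: "eventually Q (at_right (0::real))"
      and PQ: "\<And>z h. P z \<Longrightarrow> Q h \<Longrightarrow> (W (z + h *\<^sub>R v) - W z) / h < c + \<epsilon>"
      unfolding eventually_prod_filter by auto
    obtain d1 where d1: "d1 > 0" "\<And>z. dist z y < d1 \<Longrightarrow> P z"
      using P unfolding eventually_nhds_metric by blast
    obtain d2 where d2: "d2 > 0" "\<And>h. 0 < h \<Longrightarrow> h < d2 \<Longrightarrow> Q h"
      using Q unfolding eventually_at_right_field by auto
    show "\<exists>d>0. \<forall>z h. dist z y < d \<and> 0 < h \<and> h < d \<longrightarrow> W (z + h *\<^sub>R v) - W z \<le> (c + \<epsilon>) * h"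
    proof (intro exI[of _ "min d1 d2"] conjI allI impI)
      fix z h assume "dist z y < min d1 d2 \<and> 0 < h \<and> h < min d1 d2"
      then have "(W (z + h *\<^sub>R v) - W z) / h < c + \<epsilon>" "h > 0" using PQ d1 d2 by auto
      then show "W (z + h *\<^sub>R v) - W z \<le> (c + \<epsilon>) * h"
        by (simp add: pos_divide_less_eq)
    qed (use d1 d2 in auto)
  qed
next
  assume R: ?R
  show ?L
  proof (rule ereal_le_epsilon2)
    fix \<epsilon> :: real assume "\<epsilon> > 0"
    then obtain d where d: "d > 0" "\<And>z h. \<lbrakk>dist z y < d; 0 < h; h < d\<rbrakk> \<Longrightarrow> W (z + h *\<^sub>R v) - W z \<le> (c + \<epsilon>) * h"
      using R by metis
    have "clarke_dderiv W y v \<le> ereal (c + \<epsilon>)"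
      unfolding clarke_dderiv_def
    proof (rule Limsup_bounded, unfold eventually_prod_filter, intro exI conjI allI impI)
      show "eventually (\<lambda>z. dist z y < d) (nhds y)" using d(1) eventually_nhds_metric by blast
      show "eventually (\<lambda>h. 0 < h \<and> h < d) (at_right (0::real))" using d(1) eventually_at_right_field by blast
    qed (use d(2) in \<open>auto simp: pos_divide_le_eq\<close>)
    then show "clarke_dderiv W y v \<le> ereal c + ereal \<epsilon>" by simp
  qed
qed

lemma clarke_dderiv_le_lipschitz:
  fixes W :: "'a::real_normed_vector \<Rightarrow> real"
  assumes W: "L-lipschitz_on UNIV W"
  shows "clarke_dderiv W y v \<le> ereal (L * norm v)"
  unfolding clarke_dderiv_le_iff
proof (intro allI impI exI[of _ 1] conjI)
  fix \<epsilon> h :: real and z assume "\<epsilon> > 0" "dist z y < 1 \<and> 0 < h \<and> h < 1"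
  then have "W (z + h *\<^sub>R v) - W z \<le> L * (h * norm v)" "\<epsilon> * h \<ge> 0"
    using lipschitz_onD[OF W, of "z + h *\<^sub>R v" z] by (auto simp: dist_norm)
  then show "W (z + h *\<^sub>R v) - W z \<le> (L * norm v + \<epsilon>) * h" by (simp add: algebra_simps)
qed simp

text \<open>An upper limit is bounded below by samples that merely occur arbitrarily close to the
  limit. The sampled direction may differ from \<open>v\<close>, since Lipschitz continuity pays for
  the change.\<close>

lemma le_clarke_dderivI:
  fixes W :: "'a::real_normed_vector \<Rightarrow> real"
  assumes W: "L-lipschitz_on UNIV W"
    and freq: "\<And>d. d > 0 \<Longrightarrow> \<exists>z h v'. dist z y < d \<and> 0 < h \<and> h < d \<and> norm (v' - v) < d \<and> (c - d) * h \<le> W (z + h *\<^sub>R v') - W z"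
  shows "ereal c \<le> clarke_dderiv W y v"
proof (rule ereal_le_real)
  fix b assume b: "clarke_dderiv W y v \<le> ereal b"
  have L: "L \<ge> 0" using W lipschitz_on_nonneg by blast
  have "c \<le> b + e" if "e > 0" for e
  proof -
    \<comment> \<open>The sampling error and the slack in the upper bound cost
      \<open>\<epsilon>\<close> each, and the change of direction costs
      \<open>L * \<epsilon>\<close>.\<close>
    define \<epsilon> where "\<epsilon> = e / (L + 2)"
    have "\<epsilon> > 0" using that L by (simp add: \<epsilon>_def)
    then obtain d where d: "d > 0" "\<And>z h. \<lbrakk>dist z y < d; 0 < h; h < d\<rbrakk> \<Longrightarrow> W (z + h *\<^sub>R v) - W z \<le> (b + \<epsilon>) * h"
      using b unfolding clarke_dderiv_le_iff by metis
    obtain z h v' where z: "dist z y < min d \<epsilon>" "0 < h" "h < min d \<epsilon>" "norm (v' - v) < min d \<epsilon>"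
      "(c - min d \<epsilon>) * h \<le> W (z + h *\<^sub>R v') - W z"
      using freq[of "min d \<epsilon>"] d(1) \<open>\<epsilon> > 0\<close> by auto
    have "(c - \<epsilon>) * h \<le> (c - min d \<epsilon>) * h" using z by (intro mult_right_mono) auto
    moreover have "W (z + h *\<^sub>R v) - W z \<le> (b + \<epsilon>) * h" using d z by auto
    moreover have "W (z + h *\<^sub>R v') - W (z + h *\<^sub>R v) \<le> L * \<epsilon> * h"
    proof -
      have "W (z + h *\<^sub>R v') - W (z + h *\<^sub>R v) \<le> L * norm (h *\<^sub>R (v' - v))"
        using lipschitz_onD[OF W, of "z + h *\<^sub>R v'" "z + h *\<^sub>R v"] by (auto simp: dist_norm algebra_simps)
      also have "\<dots> \<le> L * (\<epsilon> * h)" using z L by (intro mult_left_mono) (auto simp: mult.commute intro: mult_right_mono less_imp_le)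
      finally show ?thesis by (simp add: mult.assoc)
    qed
    ultimately have "(c - \<epsilon>) * h \<le> (b + \<epsilon> + L * \<epsilon>) * h" using z(5) by (simp add: algebra_simps)
    then have "c - \<epsilon> \<le> b + \<epsilon> + L * \<epsilon>" using z(2) by simp
    then have "c \<le> b + (L + 2) * \<epsilon>" by (simp add: algebra_simps)
    then show ?thesis using L by (simp add: \<epsilon>_def)
  qed
  then show "ereal c \<le> ereal b" using field_le_epsilon by auto
qed

section \<open>Subgradients as supporting functionals of Clarke's derivative\<close>

lemma sublinear_supported:
  fixes p :: "'a::euclidean_space \<Rightarrow> real"
  assumes sub: "\<And>v w. p (v + w) \<le> p v + p w" and hom: "\<And>r v. r > 0 \<Longrightarrow> p (r *\<^sub>R v) = r * p v"
  obtains g where "\<And>v. g \<bullet> v \<le> p v" "g \<bullet> w = p w"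
proof -
  \<comment> \<open>A finite-dimensional Hahn-Banach argument: a hyperplane separates the strict
    epigraph of \<open>p\<close> from the graph point \<open>(w, p w)\<close>, and its normal,
    scaled to have last component -1, yields \<open>g\<close>.\<close>
  define A where "A = {(v, r). p v < r}"
  have "convex A"
    unfolding convex_def
  proof (intro ballI allI impI)
    fix x y and s t :: real assume xy: "x \<in> A" "y \<in> A" "0 \<le> s" "0 \<le> t" "s + t = 1"
    obtain v r v' r' where x: "x = (v, r)" "p v < r" and y: "y = (v', r')" "p v' < r'" using xy by (auto simp: A_def)
    consider "s = 0" | "t = 0" | "s > 0" "t > 0" using xy by linarith
    then show "s *\<^sub>R x + t *\<^sub>R y \<in> A"
    proof cases
      case 3
      have "p (s *\<^sub>R v + t *\<^sub>R v') \<le> s * p v + t * p v'" using sub[of "s *\<^sub>R v" "t *\<^sub>R v'"] hom 3 by simp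
      also have "\<dots> < s * r + t * r'" using 3 x y by (intro add_strict_mono) auto
      finally show ?thesis by (simp add: A_def x y)
    qed (use xy in auto)
  qed
  moreover have "(0, p 0 + 1) \<in> A" "A \<inter> {(w, p w)} = {}" by (auto simp: A_def)
  ultimately obtain a b where "a \<noteq> 0" and a: "\<forall>x\<in>A. a \<bullet> x \<le> b" "\<forall>x\<in>{(w, p w)}. b \<le> a \<bullet> x"
    using separating_hyperplane_sets[of A "{(w, p w)}"] by (metis convex_singleton empty_iff insert_not_empty)
  obtain \<alpha> \<beta> where ab: "a = (\<alpha>, \<beta>)" by (cases a)
  have up: "\<alpha> \<bullet> v + \<beta> * r \<le> b" if "p v < r" for v r using a(1) that by (force simp: A_def ab)
  have lo: "b \<le> \<alpha> \<bullet> w + \<beta> * p w" using a(2) by (simp add: ab)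
  have p0: "p 0 = 0" using hom[of 2 0] by simp
  \<comment> \<open>By homogeneity the epigraph is a cone; a positive value would grow beyond
    \<open>b\<close> along its ray.\<close>
  have cone: "\<alpha> \<bullet> v + \<beta> * r \<le> 0" if "p v < r" for v r
  proof (rule ccontr)
    assume neg: "\<not> ?thesis"
    define c where "c = \<alpha> \<bullet> v + \<beta> * r"
    have "c > 0" using neg by (simp add: c_def)
    define t where "t = (\<bar>b\<bar> + 1) / c"
    have "t > 0" using \<open>c > 0\<close> by (simp add: t_def)
    then have "p (t *\<^sub>R v) < t * r" using hom that by simp
    from up[OF this] have "t * c \<le> b" by (simp add: c_def algebra_simps)
    then show False using \<open>c > 0\<close> by (simp add: t_def)
  qed
  have lim: "((\<lambda>r. \<alpha> \<bullet> v + \<beta> * r) \<longlongrightarrow> \<alpha> \<bullet> v + \<beta> * p v) (at_right (p v))" for v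
    by (intro tendsto_intros)
  have closed: "\<alpha> \<bullet> v + \<beta> * p v \<le> 0" for v
    by (rule tendsto_upperbound[OF lim eventually_mono[OF eventually_at_right_less]]) (auto intro: cone)
  \<comment> \<open>The apex of the cone lies in the closure of the epigraph. Hence
    \<open>lo\<close> gives a nonnegative value at \<open>(w, p w)\<close>, opposite to
    \<open>closed\<close>, and equality follows there.\<close>
  have "b \<ge> 0"
  proof -
    have "((\<lambda>r. \<alpha> \<bullet> 0 + \<beta> * r) \<longlongrightarrow> \<alpha> \<bullet> 0 + \<beta> * p 0) (at_right (p 0))" by (rule lim)
    then have "\<alpha> \<bullet> 0 + \<beta> * p 0 \<le> b"
    proof (rule tendsto_upperbound)
      show "\<forall>\<^sub>F r in at_right (p 0). \<alpha> \<bullet> 0 + \<beta> * r \<le> b"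
        by (rule eventually_mono[OF eventually_at_right_less]) (rule up)
    qed simp
    then show ?thesis by (simp add: p0)
  qed
  \<comment> \<open>The hyperplane is not vertical: \<open>p\<close> is finite in the direction
    \<open>\<alpha>\<close>, which would force the whole normal to vanish.\<close>
  have "\<beta> \<noteq> 0"
  proof
    assume "\<beta> = 0"
    then have "\<alpha> \<bullet> \<alpha> \<le> 0" using closed[of \<alpha>] by simp
    then have "\<alpha> = 0" using inner_gt_zero_iff[of \<alpha>] by linarith
    then show False using \<open>\<beta> = 0\<close> \<open>a \<noteq> 0\<close> ab by (simp add: zero_prod_def)
  qed
  moreover have "\<beta> \<le> 0" using cone[of 0 1] by (simp add: p0)
  ultimately have "\<beta> < 0" by simp
  define g where "g = (1 / (- \<beta>)) *\<^sub>R \<alpha>"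
  have g: "g \<bullet> v = (\<alpha> \<bullet> v) / (- \<beta>)" for v by (simp add: g_def)
  have gp: "g \<bullet> v \<le> p v" for v
    unfolding g using closed[of v] \<open>\<beta> < 0\<close> by (subst pos_divide_le_eq) (auto simp: algebra_simps)
  moreover have "p w \<le> g \<bullet> w"
    unfolding g using lo \<open>b \<ge> 0\<close> \<open>\<beta> < 0\<close> by (subst pos_le_divide_eq) (auto simp: algebra_simps)
  ultimately show ?thesis using that by (meson antisym)
qed

text \<open>The step along \<open>v + w\<close> is split at \<open>z + h *\<^sub>R v\<close>.
  Subadditivity holds because Clarke's upper limit lets the base point move, so the second half may
  start there.\<close>

lemma clarke_dderiv_add_le:
  fixes W :: "'a::real_normed_vector \<Rightarrow> real"
  assumes "clarke_dderiv W y v \<le> ereal b" "clarke_dderiv W y w \<le> ereal c"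
  shows "clarke_dderiv W y (v + w) \<le> ereal (b + c)"
  unfolding clarke_dderiv_le_iff
proof (intro allI impI)
  fix \<epsilon> :: real assume "\<epsilon> > 0"
  then have "\<epsilon> / 2 > 0" by simp
  obtain d1 where d1: "d1 > 0" "\<And>z h. \<lbrakk>dist z y < d1; 0 < h; h < d1\<rbrakk> \<Longrightarrow> W (z + h *\<^sub>R v) - W z \<le> (b + \<epsilon> / 2) * h"
    using assms(1) \<open>\<epsilon> / 2 > 0\<close> unfolding clarke_dderiv_le_iff by metis
  obtain d2 where d2: "d2 > 0" "\<And>z h. \<lbrakk>dist z y < d2; 0 < h; h < d2\<rbrakk> \<Longrightarrow> W (z + h *\<^sub>R w) - W z \<le> (c + \<epsilon> / 2) * h"
    using assms(2) \<open>\<epsilon> / 2 > 0\<close> unfolding clarke_dderiv_le_iff by metis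
  \<comment> \<open>The last bound keeps the displacement \<open>h *\<^sub>R v\<close> below
    \<open>d2 / 2\<close>; the remaining half of \<open>d2\<close> covers the distance from
    \<open>z\<close> to \<open>y\<close>.\<close>
  define d where "d = min (min d1 (d2 / 2)) (d2 / 2 / (norm v + 1))"
  have nv: "norm v + 1 > 0" by (simp add: add_nonneg_pos)
  show "\<exists>d>0. \<forall>z h. dist z y < d \<and> 0 < h \<and> h < d \<longrightarrow> W (z + h *\<^sub>R (v + w)) - W z \<le> (b + c + \<epsilon>) * h"
  proof (intro exI[of _ d] conjI allI impI)
    show "d > 0" using d1 d2 nv by (simp add: d_def)
    fix z h assume zh: "dist z y < d \<and> 0 < h \<and> h < d"
    have "h * norm v \<le> h * (norm v + 1)" using zh by simp
    also have "\<dots> < d2 / 2" using zh nv by (simp only: d_def pos_less_divide_eq min_less_iff_conj)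
    finally have "norm (h *\<^sub>R v) < d2 / 2" using zh by simp
    moreover have "dist (z + h *\<^sub>R v) y \<le> norm (h *\<^sub>R v) + dist z y"
      using dist_triangle[of "z + h *\<^sub>R v" y z] by (simp add: dist_norm)
    ultimately have "dist (z + h *\<^sub>R v) y < d2" using zh by (simp add: d_def)
    then have "W ((z + h *\<^sub>R v) + h *\<^sub>R w) - W (z + h *\<^sub>R v) \<le> (c + \<epsilon> / 2) * h"
      using zh d2(1) by (intro d2) (auto simp: d_def)
    moreover have "W (z + h *\<^sub>R v) - W z \<le> (b + \<epsilon> / 2) * h"
      using zh by (intro d1) (auto simp: d_def)
    ultimately show "W (z + h *\<^sub>R (v + w)) - W z \<le> (b + c + \<epsilon>) * h"
      by (simp add: algebra_simps)
  qed
qed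

lemma clarke_dderiv_scaleR_le:
  fixes W :: "'a::real_normed_vector \<Rightarrow> real"
  assumes "clarke_dderiv W y v \<le> ereal c" "r > 0"
  shows "clarke_dderiv W y (r *\<^sub>R v) \<le> ereal (r * c)"
  unfolding clarke_dderiv_le_iff
proof (intro allI impI)
  fix \<epsilon> :: real assume "\<epsilon> > 0"
  then have "\<epsilon> / r > 0" using assms by simp
  then obtain d where d: "d > 0" "\<And>z h. \<lbrakk>dist z y < d; 0 < h; h < d\<rbrakk> \<Longrightarrow> W (z + h *\<^sub>R v) - W z \<le> (c + \<epsilon> / r) * h"
    using assms(1) unfolding clarke_dderiv_le_iff by metis
  show "\<exists>d>0. \<forall>z h. dist z y < d \<and> 0 < h \<and> h < d \<longrightarrow> W (z + h *\<^sub>R (r *\<^sub>R v)) - W z \<le> (r * c + \<epsilon>) * h"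
  proof (intro exI[of _ "min d (d / r)"] conjI allI impI)
    show "min d (d / r) > 0" using d assms by simp
    fix z h assume zh: "dist z y < min d (d / r) \<and> 0 < h \<and> h < min d (d / r)"
    have "W (z + (h * r) *\<^sub>R v) - W z \<le> (c + \<epsilon> / r) * (h * r)"
      using zh assms by (intro d) (auto simp: pos_less_divide_eq)
    also have "\<dots> = (r * c + \<epsilon>) * h" using assms by (simp add: field_simps)
    finally show "W (z + h *\<^sub>R (r *\<^sub>R v)) - W z \<le> (r * c + \<epsilon>) * h" by simp
  qed
qed

text \<open>Lipschitz continuity makes Clarke's derivative finite in every direction. It is then a
  real sublinear function, and a linear functional supporting it at \<open>w\<close> is the desired
  subgradient.\<close>

lemma clarke_subdiff_attains:
  fixes W :: "'a::euclidean_space \<Rightarrow> real"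
  assumes W: "L-lipschitz_on UNIV W"
  obtains g where "g \<in> clarke_subdiff W y" "clarke_dderiv W y w = ereal (g \<bullet> w)"
proof -
  have L: "L \<ge> 0" using W lipschitz_on_nonneg by blast
  have "ereal (- (L * norm v)) \<le> clarke_dderiv W y v" for v
  proof (rule le_clarke_dderivI[OF W])
    fix d :: real assume "d > 0"
    have "\<bar>W (y + (d / 2) *\<^sub>R v) - W y\<bar> \<le> L * ((d / 2) * norm v)"
      using lipschitz_onD[OF W, of "y + (d / 2) *\<^sub>R v" y] \<open>d > 0\<close> by (simp add: dist_norm)
    then have "- (L * ((d / 2) * norm v)) \<le> W (y + (d / 2) *\<^sub>R v) - W y" by linarith
    moreover have "(- (L * norm v) - d) * (d / 2) \<le> - (L * ((d / 2) * norm v))"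
      using \<open>d > 0\<close> by (simp add: algebra_simps)
    ultimately show "\<exists>z h v'. dist z y < d \<and> 0 < h \<and> h < d \<and> norm (v' - v) < d \<and> (- (L * norm v) - d) * h \<le> W (z + h *\<^sub>R v') - W z"
      using \<open>d > 0\<close> by (intro exI[of _ y] exI[of _ "d / 2"] exI[of _ v]) auto
  qed
  moreover have "clarke_dderiv W y v \<le> ereal (L * norm v)" for v
    by (rule clarke_dderiv_le_lipschitz[OF W])
  ultimately have "\<exists>r. clarke_dderiv W y v = ereal r" for v
    by (metis ereal_infty_less_eq(1) ereal_infty_less_eq(2) PInfty_neq_ereal(1) MInfty_neq_ereal(1) real_of_ereal.cases)
  then obtain p where p: "\<And>v. clarke_dderiv W y v = ereal (p v)" by metis
  have sub: "p (v + w) \<le> p v + p w" for v w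
    using clarke_dderiv_add_le[of W y v "p v" w "p w"] by (simp add: p)
  have hom_le: "p (r *\<^sub>R v) \<le> r * p v" if "r > 0" for r v
    using clarke_dderiv_scaleR_le[of W y v "p v" r] that by (simp add: p)
  have hom: "p (r *\<^sub>R v) = r * p v" if "r > 0" for r v
  proof (rule antisym[OF hom_le[OF that]])
    have "p ((1 / r) *\<^sub>R (r *\<^sub>R v)) \<le> (1 / r) * p (r *\<^sub>R v)" using that by (intro hom_le) simp
    then show "r * p v \<le> p (r *\<^sub>R v)" using that by (simp add: field_simps)
  qed
  obtain g where "\<And>v. g \<bullet> v \<le> p v" "g \<bullet> w = p w"
    using sublinear_supported[of p w] sub hom by blast
  then show ?thesis using that[of g] by (simp add: clarke_subdiff_def p)
qed

text \<open>The subgradient inequality is tested in the direction \<open>g\<close> itself.\<close>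

lemma clarke_subdiff_norm_le:
  fixes W :: "'a::euclidean_space \<Rightarrow> real"
  assumes W: "L-lipschitz_on UNIV W" and g: "g \<in> clarke_subdiff W y"
  shows "norm g \<le> L"
proof (cases "g = 0")
  case False
  have "ereal (g \<bullet> g) \<le> ereal (L * norm g)"
    using g clarke_dderiv_le_lipschitz[OF W, of y g] unfolding clarke_subdiff_def
    by (metis (mono_tags, lifting) mem_Collect_eq order_trans)
  then have "norm g * norm g \<le> L * norm g" by (simp add: power2_norm_eq_inner[symmetric] power2_eq_square)
  then show ?thesis using False by simp
next
  case True
  then show ?thesis using W lipschitz_on_nonneg by auto
qed

text \<open>A descent from \<open>y\<close> along \<open>v'\<close>, read backwards, is an ascent
  from \<open>y + h *\<^sub>R v'\<close> along \<open>- v'\<close>. Thus Clarke's derivative in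
  direction \<open>- v\<close> is at least \<open>- c\<close>, and a subgradient attaining it has
  slope at most \<open>c\<close> along \<open>v\<close>.\<close>

lemma clarke_subdiff_descent:
  fixes W :: "'a::euclidean_space \<Rightarrow> real"
  assumes W: "L-lipschitz_on UNIV W"
    and freq: "\<And>d. d > 0 \<Longrightarrow> \<exists>h v'. 0 < h \<and> h < d \<and> norm (v' - v) < d \<and> W (y + h *\<^sub>R v') - W y \<le> (c + d) * h"
  obtains g where "g \<in> clarke_subdiff W y" "g \<bullet> v \<le> c"
proof -
  obtain g where g: "g \<in> clarke_subdiff W y" "clarke_dderiv W y (- v) = ereal (g \<bullet> (- v))"
    using clarke_subdiff_attains[OF W] by blast
  have "ereal (- c) \<le> clarke_dderiv W y (- v)"
  proof (rule le_clarke_dderivI[OF W])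
    fix d :: real assume "d > 0"
    have nv: "norm v + 1 + d > 0" using \<open>d > 0\<close> by (simp add: add_nonneg_pos)
    \<comment> \<open>The second bound keeps the new base point \<open>y + h *\<^sub>R v'\<close>
      within \<open>d\<close> of \<open>y\<close>, as \<open>norm v'\<close> is at most
      \<open>norm v + 1 + d\<close>.\<close>
    define e where "e = min d (d / (norm v + 1 + d))"
    have "e > 0" using \<open>d > 0\<close> nv by (simp add: e_def)
    then obtain h v' where h: "0 < h" "h < e" "norm (v' - v) < e" "W (y + h *\<^sub>R v') - W y \<le> (c + e) * h"
      using freq by blast
    have "norm v' \<le> norm v + norm (v' - v)" by (metis add.commute diff_add_cancel norm_triangle_ineq)
    also have "\<dots> \<le> norm v + 1 + d" using h by (simp add: e_def)
    finally have "h * norm v' \<le> h * (norm v + 1 + d)" using h by (intro mult_left_mono) auto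
    also have "\<dots> < d" using h nv by (simp add: e_def pos_less_divide_eq)
    finally have near: "dist (y + h *\<^sub>R v') y < d" using h by (simp add: dist_norm)
    have "(- c - d) * h \<le> (- c - e) * h" using h by (intro mult_right_mono) (auto simp: e_def)
    also have "\<dots> \<le> W ((y + h *\<^sub>R v') + h *\<^sub>R (- v')) - W (y + h *\<^sub>R v')"
      using h(4) by (simp add: algebra_simps)
    finally show "\<exists>z h v'. dist z y < d \<and> 0 < h \<and> h < d \<and> norm (v' - - v) < d \<and> (- c - d) * h \<le> W (z + h *\<^sub>R v') - W z"
      using near h by (intro exI[of _ "y + h *\<^sub>R v'"] exI[of _ h] exI[of _ "- v'"])
        (auto simp: e_def norm_minus_commute)
  qed
  then show ?thesis using that g by simp
qed

text \<open>Real suprema dominate their members only for families bounded above. Compactness bounds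
  \<open>DV\<close> and the Lipschitz constant bounds the subgradients; nonempty subdifferentials
  let the inner suprema inherit the bound.\<close>

lemma norm_grad_diff_le_grad_dist:
  fixes W :: "'a::euclidean_space \<Rightarrow> real"
  assumes W: "L-lipschitz_on UNIV W" and Y: "compact Y" "continuous_on Y DV"
    and y: "y \<in> Y" and g: "g \<in> clarke_subdiff W y"
  shows "norm (DV y - g) \<le> grad_dist Y DV W"
proof -
  have "bounded (DV ` Y)" using Y compact_continuous_image compact_imp_bounded by blast
  then obtain B where B: "\<And>z. z \<in> Y \<Longrightarrow> norm (DV z) \<le> B" by (auto simp: bounded_iff)
  have le: "norm (DV z - g') \<le> B + L" if "z \<in> Y" "g' \<in> clarke_subdiff W z" for z g'
    using norm_triangle_ineq4[of "DV z" g'] B[OF that(1)] clarke_subdiff_norm_le[OF W that(2)] by linarith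
  have "norm (DV y - g) \<le> (SUP g\<in>clarke_subdiff W y. norm (DV y - g))"
    using g le[OF y] by (intro cSUP_upper bdd_aboveI2)
  also have "\<dots> \<le> grad_dist Y DV W"
    unfolding grad_dist_def
  proof (rule cSUP_upper[OF y bdd_aboveI2])
    fix z assume "z \<in> Y"
    have "clarke_subdiff W z \<noteq> {}" using clarke_subdiff_attains[OF W] by blast
    then show "(SUP g\<in>clarke_subdiff W z. norm (DV z - g)) \<le> B + L"
      using le[OF \<open>z \<in> Y\<close>] by (intro cSUP_least)
  qed
  finally show ?thesis .
qed

text \<open>The base point \<open>(u, x u)\<close> moves with \<open>u\<close>, which Clarke's upper
  limit permits. The curve leaves the straight step along \<open>(1, D)\<close> by a small multiple
  of \<open>v - u\<close>, and \<open>W\<close> is Lipschitz.\<close>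

lemma clarke_dderiv_along_trajectory:
  fixes W :: "real \<times> 'a::euclidean_space \<Rightarrow> real"
  assumes W: "L-lipschitz_on UNIV W"
    and D: "(x has_vector_derivative D) (at s within {a..b})"
    and c: "clarke_dderiv W (s, x s) (1, D) \<le> ereal c"
    and "\<epsilon> > 0"
  shows "\<exists>d>0. \<forall>u v. a \<le> u \<and> s - d < u \<and> u \<le> s \<and> s \<le> v \<and> v < s + d \<and> v \<le> b
            \<longrightarrow> W (v, x v) - W (u, x u) \<le> (c + \<epsilon>) * (v - u)"
proof -
  have L: "L \<ge> 0" using W lipschitz_on_nonneg by blast
  \<comment> \<open>Half of \<open>\<epsilon>\<close> goes to Clarke's quotient, half to the
    deviation from the tangent after multiplication by \<open>L\<close>.\<close>
  have "\<epsilon> / 2 > 0" "\<epsilon> / (2 * (L + 1)) > 0" using \<open>\<epsilon> > 0\<close> L by auto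
  obtain d1 where d1: "d1 > 0" "\<And>z h. \<lbrakk>dist z (s, x s) < d1; 0 < h; h < d1\<rbrakk> \<Longrightarrow> W (z + h *\<^sub>R (1, D)) - W z \<le> (c + \<epsilon> / 2) * h"
    using c \<open>\<epsilon> / 2 > 0\<close> unfolding clarke_dderiv_le_iff by metis
  obtain d2 where d2: "d2 > 0" "\<And>u v. \<lbrakk>a \<le> u; s - d2 < u; u \<le> s; s \<le> v; v < s + d2; v \<le> b\<rbrakk>
            \<Longrightarrow> norm (x v - x u - (v - u) *\<^sub>R D) \<le> \<epsilon> / (2 * (L + 1)) * (v - u)"
    using has_vector_derivative_straddle[OF D \<open>\<epsilon> / (2 * (L + 1)) > 0\<close>] by metis
  have "continuous (at s within {a..b}) (\<lambda>s. (s, x s))"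
    by (intro continuous_Pair continuous_ident has_vector_derivative_continuous[OF D])
  then obtain d3 where d3: "d3 > 0" "\<And>u. \<lbrakk>u \<in> {a..b}; dist u s < d3\<rbrakk> \<Longrightarrow> dist (u, x u) (s, x s) < d1"
    using d1(1) unfolding continuous_within_eps_delta by metis
  define d where "d = min (d1 / 2) (min d2 d3)"
  have "W (v, x v) - W (u, x u) \<le> (c + \<epsilon>) * (v - u)"
    if uv: "a \<le> u" "s - d < u" "u \<le> s" "s \<le> v" "v < s + d" "v \<le> b" for u v
  proof (cases "u = v")
    case False
    define h where "h = v - u"
    have h: "0 < h" "h < d1" using uv False by (auto simp: h_def d_def)
    have "dist (u, x u) (s, x s) < d1" using uv by (intro d3) (auto simp: dist_real_def d_def)
    from d1(2)[OF this h] have 1: "W ((u, x u) + h *\<^sub>R (1, D)) - W (u, x u) \<le> (c + \<epsilon> / 2) * h" .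
    have diff: "(v, x v) - ((u, x u) + h *\<^sub>R (1, D)) = (0, x v - x u - (v - u) *\<^sub>R D)"
      by (simp add: h_def)
    have "dist (v, x v) ((u, x u) + h *\<^sub>R (1, D)) = norm (x v - x u - (v - u) *\<^sub>R D)"
      unfolding dist_norm diff by (simp add: norm_Pair)
    then have "W (v, x v) - W ((u, x u) + h *\<^sub>R (1, D)) \<le> L * norm (x v - x u - (v - u) *\<^sub>R D)"
      using lipschitz_onD[OF W, of "(v, x v)" "(u, x u) + h *\<^sub>R (1, D)"]
      unfolding dist_real_def by simp
    also have "\<dots> \<le> L * (\<epsilon> / (2 * (L + 1)) * (v - u))"
      using uv L by (intro mult_left_mono d2) (auto simp: d_def)
    also have "\<dots> = (L * (\<epsilon> / (2 * (L + 1)))) * h" by (simp add: h_def)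
    also have "\<dots> \<le> (\<epsilon> / 2) * h"
      using h L \<open>\<epsilon> > 0\<close> by (intro mult_right_mono) (auto simp: field_simps)
    finally have "W (v, x v) - W (u, x u) \<le> (c + \<epsilon> / 2) * h + \<epsilon> / 2 * h" using 1 by linarith
    then show ?thesis by (simp add: h_def ring_distribs)
  qed simp
  moreover have "d > 0" using d1 d2 d3 by (simp add: d_def)
  ultimately show ?thesis by blast
qed

text \<open>Integrated form of the preceding local bound; composition with the Lipschitz function
  \<open>W\<close> keeps the absolute continuity that the growth estimate requires.\<close>

lemma clarke_dderiv_growth:
  fixes W :: "real \<times> 'a::euclidean_space \<Rightarrow> real"
  assumes W: "L-lipschitz_on UNIV W" and ab: "a \<le> b" and ac: "abs_continuous_on a b x"
    and ae: "AE s in lebesgue_on {a..b}. \<exists>D. (x has_vector_derivative D) (at s within {a..b}) \<and>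
               clarke_dderiv W (s, x s) (1, D) \<le> ereal c"
  shows "W (b, x b) - W (a, x a) \<le> c * (b - a)"
proof -
  let ?N = "{s\<in>{a..b}. \<not> (\<exists>D. (x has_vector_derivative D) (at s within {a..b}) \<and> clarke_dderiv W (s, x s) (1, D) \<le> ereal c)}"
  have "negligible ?N" using ae by (simp add: AE_lebesgue_on_iff_negligible)
  then show ?thesis
  proof (rule abs_continuous_growth[OF ab abs_continuous_on_compose_lipschitz[OF ac W]])
    fix s \<epsilon> :: real assume "s \<in> {a..b} - ?N" "\<epsilon> > 0"
    then obtain D where "(x has_vector_derivative D) (at s within {a..b})"
      "clarke_dderiv W (s, x s) (1, D) \<le> ereal c" "\<epsilon> > 0" by auto
    from clarke_dderiv_along_trajectory[OF W this]
    show "\<exists>d>0. \<forall>u v. a \<le> u \<and> s - d < u \<and> u \<le> s \<and> s \<le> v \<and> v < s + d \<and> v \<le> b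
              \<longrightarrow> W (v, x v) - W (u, x u) \<le> (c + \<epsilon>) * (v - u)" .
  qed
qed

section \<open>Dynamic programming\<close>

text \<open>A violation of a closed constraint persists, by continuity, on an interval of positive
  length. The assumption \<open>a < b\<close> provides that length even at an endpoint.\<close>

lemma continuous_AE_in_closed:
  fixes x :: "real \<Rightarrow> 'a::metric_space"
  assumes "a < b" and cont: "continuous_on {a..b} x" and X: "closed X"
    and ae: "AE s in lebesgue_on {a..b}. x s \<in> X" and s: "s \<in> {a..b}"
  shows "x s \<in> X"
proof (rule ccontr)
  assume "x s \<notin> X"
  then obtain e where "e > 0" and e: "ball (x s) e \<subseteq> - X"
    using openE[of "- X" "x s"] X by auto
  obtain d where "d > 0" and d: "\<And>r. \<lbrakk>r \<in> {a..b}; dist r s < d\<rbrakk> \<Longrightarrow> dist (x r) (x s) < e"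
    using cont s \<open>e > 0\<close> unfolding continuous_on_iff by metis
  define l where "l = max a (s - d / 2)"
  define r where "r = min b (s + d / 2)"
  have "l < r" using \<open>a < b\<close> s \<open>d > 0\<close> by (auto simp: l_def r_def)
  have "{l..r} \<subseteq> {s\<in>{a..b}. x s \<notin> X}"
  proof
    fix q assume "q \<in> {l..r}"
    then have "q \<in> {a..b}" "dist q s < d" using \<open>d > 0\<close> by (auto simp: l_def r_def dist_real_def)
    then show "q \<in> {s\<in>{a..b}. x s \<notin> X}" using d[of q] e by (auto simp: dist_commute subset_iff)
  qed
  moreover have "negligible {s\<in>{a..b}. x s \<notin> X}"
    using ae by (simp add: AE_lebesgue_on_iff_negligible)
  ultimately have "negligible {l..r}" using negligible_subset by blast
  then show False using \<open>l < r\<close> negligible_interval(1)[of l r] by simp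
qed

lemma ode_solution_subset:
  assumes "ode_solution f a b u x" "a \<le> c" "d \<le> b"
  shows "ode_solution f c d u x"
  unfolding ode_solution_def
proof
  show "abs_continuous_on c d x"
    using assms abs_continuous_on_subset unfolding ode_solution_def by blast
  have "AE t in lebesgue_on {a..b}. (x has_vector_derivative f (t, x t, u t)) (at t within {a..b})"
    using assms(1) by (simp add: ode_solution_def)
  then show "AE t in lebesgue_on {c..d}. (x has_vector_derivative f (t, x t, u t)) (at t within {c..d})"
    by (rule AE_lebesgue_on_subset)
      (use assms in \<open>auto intro: has_vector_derivative_within_subset\<close>)
qed

text \<open>The half of dynamic programming used below: what remains of a trajectory competes for
  the value at the point reached.\<close>

lemma admissible_controls_tail:
  assumes u: "u \<in> borel_measurable (lebesgue_on {t0..t1})" "bounded (u ` {t0..t1})" "\<forall>t\<in>{t0..t1}. u t \<in> U"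
    and x: "ode_solution f t0 t1 u x" "AE t in lebesgue_on {t0..t1}. x t \<in> X" "x t1 \<in> K"
    and s: "t0 \<le> s"
  shows "u \<in> admissible_controls f U X K s t1 (x s)"
proof -
  have sub: "{s..t1} \<subseteq> {t0..t1}" using s by auto
  have "u \<in> borel_measurable (lebesgue_on {s..t1})"
    using measurable_restrict_mono[OF u(1) sub] .
  moreover have "bounded (u ` {s..t1})" using u(2) sub by (meson bounded_subset image_mono)
  moreover have "AE t in lebesgue_on {s..t1}. x t \<in> X"
    using AE_lebesgue_on_subset[OF x(2) sub] by auto
  ultimately show ?thesis
    using u(3) sub x(3) ode_solution_subset[OF x(1) s order_refl]
    unfolding admissible_controls_def by blast
qed

text \<open>A control of cost below \<open>m\<close> is followed for time \<open>h\<close>. The last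
  conclusion says, through all half-spaces, that the mean velocity is close to the closed convex
  hull of the velocities available at \<open>(t, \<xi>)\<close>; linear functionals replace
  vector-valued integrals.\<close>

lemma near_optimal_step:
  fixes f :: "real \<times> (real^'n) \<times> (real^'m) \<Rightarrow> real^'n"
  assumes f: "Lf-lipschitz_on UNIV f" and X: "compact X"
    and B: "\<forall>s\<in>{t..Ts}. \<forall>x\<in>X. \<forall>w\<in>U. norm (f (s, x, w)) \<le> B" and "B \<ge> 0"
    and r: "\<forall>z\<in>K. r \<le> dist \<xi> z" and h: "0 < h" "B * h < r"
    and val: "min_time f U X K Ts (t, \<xi>) < ereal m"
  obtains z where "z \<in> X" "min_time f U X K Ts (t + h, z) \<le> ereal (m - h)"
    "norm (z - \<xi>) \<le> B * h"
    "\<And>a c. (\<And>w. w \<in> U \<Longrightarrow> a \<bullet> f (t, \<xi>, w) \<le> c) \<Longrightarrow> a \<bullet> (z - \<xi>) \<le> (c + norm a * (Lf * (h + B * h))) * h"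
proof -
  obtain t1 u where t1: "t1 \<in> {t..Ts}" "t1 - t < m" and uadm: "u \<in> admissible_controls f U X K t t1 \<xi>"
    using val unfolding min_time_def by (auto simp: Inf_less_iff)
  obtain x where u: "u \<in> borel_measurable (lebesgue_on {t..t1})" "bounded (u ` {t..t1})" "\<forall>s\<in>{t..t1}. u s \<in> U"
    and x: "ode_solution f t t1 u x" "x t = \<xi>" "AE s in lebesgue_on {t..t1}. x s \<in> X" "x t1 \<in> K"
    using uadm unfolding admissible_controls_def by blast
  have Lf: "Lf \<ge> 0" using f lipschitz_on_nonneg by blast
  have ode: "AE s in lebesgue_on {t..t1}. (x has_vector_derivative f (s, x s, u s)) (at s within {t..t1})"
    and ac: "abs_continuous_on t t1 x"
    using x(1) by (auto simp: ode_solution_def)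
  have "r \<le> dist \<xi> (x t1)" using r x(4) by blast
  have "norm (x s - x t) \<le> B * (s - t)" if s: "s \<in> {t..t1}" for s
  proof (rule abs_continuous_norm_growth)
    show "t \<le> s" "abs_continuous_on t s x" using s abs_continuous_on_subset[OF ac] by auto
    have "AE s in lebesgue_on {t..t1}. (x has_vector_derivative f (s, x s, u s)) (at s within {t..t1}) \<and> x s \<in> X"
      using ode x(3) by eventually_elim auto
    then show "AE q in lebesgue_on {t..s}. \<exists>D. (x has_vector_derivative D) (at q within {t..s}) \<and> norm D \<le> B"
    proof (rule AE_lebesgue_on_subset)
      fix q assume q: "q \<in> {t..s}" "(x has_vector_derivative f (q, x q, u q)) (at q within {t..t1}) \<and> x q \<in> X"
      then have "norm (f (q, x q, u q)) \<le> B" using B u(3) s t1 by simp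
      moreover have "(x has_vector_derivative f (q, x q, u q)) (at q within {t..s})"
        using q s by (auto intro: has_vector_derivative_within_subset)
      ultimately show "\<exists>D. (x has_vector_derivative D) (at q within {t..s}) \<and> norm D \<le> B" by blast
    qed (use s in auto)
  qed
  then have speed: "norm (x s - \<xi>) \<le> B * (s - t)" if "s \<in> {t..t1}" for s using that x(2) by simp
  \<comment> \<open>The trajectory ends in the target, at distance at least \<open>r\<close>, and at
    speed at most \<open>B\<close> this takes longer than \<open>h\<close>.\<close>
  have "B * h < B * (t1 - t)"
    using speed[of t1] t1 \<open>r \<le> dist \<xi> (x t1)\<close> h by (simp add: dist_norm norm_minus_commute)
  then have "t + h < t1" using mult_left_less_imp_less[of B h "t1 - t"] \<open>B \<ge> 0\<close> by simp
  \<comment> \<open>The interval is now known to be nondegenerate, so the almost everywhere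
    constraint holds at every time.\<close>
  have xX: "x s \<in> X" if "s \<in> {t..t1}" for s
    using continuous_AE_in_closed[OF _ abs_continuous_on_imp_continuous_on[OF ac] compact_imp_closed[OF X] x(3) that]
      \<open>t + h < t1\<close> h by simp
  show ?thesis
  proof (rule that[of "x (t + h)"])
    show "x (t + h) \<in> X" using \<open>t + h < t1\<close> h by (intro xX) auto
    show "norm (x (t + h) - \<xi>) \<le> B * h" using speed[of "t + h"] \<open>t + h < t1\<close> h by simp
    have "u \<in> admissible_controls f U X K (t + h) t1 (x (t + h))"
      using admissible_controls_tail[OF u x(1,3,4)] h by simp
    then have "min_time f U X K Ts (t + h, x (t + h)) \<le> ereal (t1 - (t + h))"
      unfolding min_time_def using t1 \<open>t + h < t1\<close> by (auto intro!: Inf_lower)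
    also have "\<dots> \<le> ereal (m - h)" using t1 by simp
    finally show "min_time f U X K Ts (t + h, x (t + h)) \<le> ereal (m - h)" .
    fix a c assume c: "\<And>w. w \<in> U \<Longrightarrow> a \<bullet> f (t, \<xi>, w) \<le> c"
    let ?c = "c + norm a * (Lf * (h + B * h))"
    have "a \<bullet> (x (t + h) - x t) \<le> ?c * (t + h - t)"
    proof (rule abs_continuous_inner_growth)
      show "t \<le> t + h" "abs_continuous_on t (t + h) x"
        using h \<open>t + h < t1\<close> abs_continuous_on_subset[OF ac] by auto
      show "AE q in lebesgue_on {t..t + h}. \<exists>D. (x has_vector_derivative D) (at q within {t..t + h}) \<and> a \<bullet> D \<le> ?c"
        using ode
      proof (rule AE_lebesgue_on_subset)
        fix q assume q: "q \<in> {t..t + h}" "(x has_vector_derivative f (q, x q, u q)) (at q within {t..t1})"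
        have qt: "q \<in> {t..t1}" using q \<open>t + h < t1\<close> by auto
        \<comment> \<open>The control value is kept, and only time and state are frozen at
          \<open>(t, \<xi>)\<close>; \<open>f\<close> changes by at most \<open>Lf\<close> times
          this distance.\<close>
        have "norm ((q, x q, u q) - (t, \<xi>, u q)) \<le> norm (q - t) + norm (x q - \<xi>)"
          using norm_Pair_le[of "q - t" "(x q - \<xi>, 0 :: real^'m)"] by (simp add: norm_Pair)
        also have "\<dots> \<le> h + B * h"
          using q speed[OF qt] mult_left_mono[of "q - t" h B] \<open>B \<ge> 0\<close> by auto
        finally have "norm ((q, x q, u q) - (t, \<xi>, u q)) \<le> h + B * h" .
        then have "Lf * norm ((q, x q, u q) - (t, \<xi>, u q)) \<le> Lf * (h + B * h)"
          using Lf by (rule mult_left_mono)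
        then have "norm (f (q, x q, u q) - f (t, \<xi>, u q)) \<le> Lf * (h + B * h)"
          using lipschitz_onD[OF f, of "(q, x q, u q)" "(t, \<xi>, u q)"] by (simp add: dist_norm)
        then have "a \<bullet> (f (q, x q, u q) - f (t, \<xi>, u q)) \<le> norm a * (Lf * (h + B * h))"
          by (meson mult_left_mono norm_cauchy_schwarz norm_ge_zero order_trans)
        moreover have "a \<bullet> f (t, \<xi>, u q) \<le> c" using c u(3) qt by blast
        ultimately have "a \<bullet> f (q, x q, u q) \<le> ?c" by (simp add: inner_diff_right)
        moreover have "(x has_vector_derivative f (q, x q, u q)) (at q within {t..t + h})"
          using q \<open>t + h < t1\<close> by (auto intro: has_vector_derivative_within_subset)
        ultimately show "\<exists>D. (x has_vector_derivative D) (at q within {t..t + h}) \<and> a \<bullet> D \<le> ?c" by blast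
      qed (use \<open>t + h < t1\<close> in auto)
    qed
    then show "a \<bullet> (x (t + h) - \<xi>) \<le> ?c * h" by (simp add: x(2))
  qed
qed

text \<open>Mean velocities of ever shorter near-optimal steps have a limit point. A limit outside
  the compact convex velocity set would be strictly separated from it, against the half-space bounds
  on the steps; so the limit is the velocity of some control value \<open>w\<close>.\<close>

lemma value_descent_direction:
  fixes f :: "real \<times> (real^'n) \<times> (real^'m) \<Rightarrow> real^'n"
  assumes f: "Lf-lipschitz_on UNIV f" and U: "compact U" and X: "compact X" and K: "compact K"
    and t: "0 \<le> t" "t < T" and \<xi>: "\<xi> \<in> X - K"
    and conv: "convex ((\<lambda>w. f (t, \<xi>, w)) ` U)"
    and Vs: "\<And>y. y \<in> {0..T} \<times> X \<Longrightarrow> ereal (Vs y) = min_time f U X K Ts y"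
  obtains w where "w \<in> U"
    "\<And>d. d > 0 \<Longrightarrow> \<exists>h v'. 0 < h \<and> h < d \<and> norm (v' - (1, f (t, \<xi>, w))) < d \<and>
       Vs ((t, \<xi>) + h *\<^sub>R v') - Vs (t, \<xi>) \<le> (- 1 + d) * h"
proof -
  have contf: "continuous_on S f" for S
    using f lipschitz_on_continuous_on continuous_on_subset by blast
  have "compact (f ` ({t..Ts} \<times> X \<times> U))"
    by (intro compact_continuous_image contf compact_Times compact_Icc X U)
  then obtain B where "B > 0" and B: "\<forall>s\<in>{t..Ts}. \<forall>x\<in>X. \<forall>w\<in>U. norm (f (s, x, w)) \<le> B"
    using compact_imp_bounded bounded_pos by (metis (mono_tags, lifting) SigmaI imageI)
  obtain r where "r > 0" and r: "\<forall>z\<in>K. r \<le> dist \<xi> z"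
    using separate_point_closed[OF compact_imp_closed[OF K], of \<xi>] \<xi> by auto
  \<comment> \<open>The first bound keeps \<open>t + h n\<close> within the horizon on which
    \<open>Vs\<close> is the value function, the second gives
    \<open>B * h n \<le> r / 2\<close>.\<close>
  define h where "h n = min ((T - t) / 2) (r / (2 * B)) / real (Suc n)" for n
  have h0: "h n > 0" for n using t \<open>r > 0\<close> \<open>B > 0\<close> by (simp add: h_def)
  have hle: "h n \<le> min ((T - t) / 2) (r / (2 * B))" for n
    using t \<open>r > 0\<close> \<open>B > 0\<close> divide_left_mono[of 1 "real (Suc n)" "min ((T - t) / 2) (r / (2 * B))"]
    unfolding h_def by (simp del: of_nat_Suc)
  have hT: "t + h n \<le> T" for n using hle[of n] t by (simp add: field_simps)
  have hr: "B * h n < r" for n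
  proof -
    have "B * h n \<le> B * (r / (2 * B))" using hle[of n] \<open>B > 0\<close> by (intro mult_left_mono) auto
    then show ?thesis using \<open>B > 0\<close> \<open>r > 0\<close> by simp
  qed
  have hlim: "h \<longlonglongrightarrow> 0"
    using tendsto_mult_left[OF LIMSEQ_inverse_real_of_nat, of "min ((T - t) / 2) (r / (2 * B))"]
    unfolding h_def[abs_def] divide_inverse[of _ "real (Suc _)"] by (simp del: of_nat_Suc)
  let ?P = "\<lambda>n z. z \<in> X \<and> min_time f U X K Ts (t + h n, z) \<le> ereal (Vs (t, \<xi>) + h n ^ 2 - h n) \<and>
      norm (z - \<xi>) \<le> B * h n \<and>
      (\<forall>a c. (\<forall>w\<in>U. a \<bullet> f (t, \<xi>, w) \<le> c) \<longrightarrow> a \<bullet> (z - \<xi>) \<le> (c + norm a * (Lf * (h n + B * h n))) * h n)"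
  have "\<exists>z. ?P n z" for n
  proof -
    \<comment> \<open>The excess \<open>h n ^ 2\<close> is positive, so a control with this accuracy
      exists, and of lower order than \<open>h n\<close>, so the unit rate of decrease survives in
      the limit.\<close>
    have "min_time f U X K Ts (t, \<xi>) < ereal (Vs (t, \<xi>) + h n ^ 2)"
      using Vs[of "(t, \<xi>)"] t \<xi> h0[of n] by (simp flip: Vs)
    then show ?thesis
    proof (rule near_optimal_step[OF f X B less_imp_le[OF \<open>B > 0\<close>] r h0 hr])
      fix z assume "z \<in> X" "min_time f U X K Ts (t + h n, z) \<le> ereal (Vs (t, \<xi>) + h n ^ 2 - h n)"
        "norm (z - \<xi>) \<le> B * h n"
        "\<And>a c. (\<And>w. w \<in> U \<Longrightarrow> a \<bullet> f (t, \<xi>, w) \<le> c) \<Longrightarrow> a \<bullet> (z - \<xi>) \<le> (c + norm a * (Lf * (h n + B * h n))) * h n"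
      then show ?thesis by (intro exI[of _ z]) simp
    qed
  qed
  then obtain z where z: "\<And>n. ?P n (z n)" by metis
  define v where "v n = (1 / h n) *\<^sub>R (z n - \<xi>)" for n
  have hv: "h n *\<^sub>R v n = z n - \<xi>" for n using h0[of n] by (simp add: v_def)
  have "v n \<in> cball 0 B" for n
    using z[of n] h0[of n] by (simp add: v_def divide_le_eq)
  then obtain v0 \<sigma> where \<sigma>: "strict_mono \<sigma>" and v0: "(v \<circ> \<sigma>) \<longlonglongrightarrow> v0"
    using compact_cball[of "0::real^'n" B] unfolding compact_def by metis
  have h\<sigma>: "(\<lambda>n. h (\<sigma> n)) \<longlonglongrightarrow> 0" using LIMSEQ_subseq_LIMSEQ[OF hlim \<sigma>] by (simp add: o_def)
  have "v0 \<in> (\<lambda>w. f (t, \<xi>, w)) ` U"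
  proof (rule ccontr)
    assume "v0 \<notin> (\<lambda>w. f (t, \<xi>, w)) ` U"
    moreover have "continuous_on U (\<lambda>w. f (t, \<xi>, w))"
      by (intro continuous_on_compose2[OF contf[of UNIV]] continuous_intros) auto
    then have "closed ((\<lambda>w. f (t, \<xi>, w)) ` U)"
      using U compact_continuous_image compact_imp_closed by blast
    ultimately obtain a b where ab: "a \<bullet> v0 < b" "\<And>w. w \<in> U \<Longrightarrow> a \<bullet> f (t, \<xi>, w) > b"
      using separating_hyperplane_closed_point[OF conv] by blast
    \<comment> \<open>Separation bounds the available velocities from below, whereas the steps carry
      upper bounds, hence the sign change. The error term vanishes as \<open>n\<close>
      grows.\<close>
    have "(- a) \<bullet> v n \<le> - b + norm a * (Lf * (h n + B * h n))" for n
    proof -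
      have "\<forall>w\<in>U. (- a) \<bullet> f (t, \<xi>, w) \<le> - b" using ab(2) by (auto intro: less_imp_le)
      then have "(- a) \<bullet> (h n *\<^sub>R v n) \<le> (- b + norm (- a) * (Lf * (h n + B * h n))) * h n"
        using z[of n] unfolding hv by blast
      then have "h n * ((- a) \<bullet> v n) \<le> h n * (- b + norm a * (Lf * (h n + B * h n)))"
        by (simp only: inner_scaleR_right norm_minus_cancel mult.commute)
      then show ?thesis using h0[of n] by (simp only: mult_le_cancel_left_pos)
    qed
    then have "(- a) \<bullet> (v \<circ> \<sigma>) n \<le> - b + norm a * (Lf * (h (\<sigma> n) + B * h (\<sigma> n)))" for n by simp
    moreover have "(\<lambda>n. (- a) \<bullet> (v \<circ> \<sigma>) n) \<longlonglongrightarrow> (- a) \<bullet> v0"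
      by (intro tendsto_intros v0)
    moreover have "(\<lambda>n. - b + norm a * (Lf * (h (\<sigma> n) + B * h (\<sigma> n)))) \<longlonglongrightarrow> - b + norm a * (Lf * (0 + B * 0))"
      by (intro tendsto_intros h\<sigma>)
    ultimately have "(- a) \<bullet> v0 \<le> - b + norm a * (Lf * (0 + B * 0))"
      by (intro LIMSEQ_le) auto
    then show False using ab(1) by simp
  qed
  then obtain w where w: "w \<in> U" "v0 = f (t, \<xi>, w)" by blast
  show ?thesis
  proof (rule that[OF w(1)])
    fix d :: real assume "d > 0"
    have "\<forall>\<^sub>F n in sequentially. h (\<sigma> n) < d \<and> dist ((v \<circ> \<sigma>) n) v0 < d"
      using order_tendstoD(2)[OF h\<sigma> \<open>d > 0\<close>] tendstoD[OF v0 \<open>d > 0\<close>] by eventually_elim auto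
    then obtain n where n: "h (\<sigma> n) < d" "norm (v (\<sigma> n) - v0) < d"
      unfolding eventually_sequentially by (auto simp: dist_norm)
    let ?k = "\<sigma> n"
    have eq: "(t, \<xi>) + h ?k *\<^sub>R (1, v ?k) = (t + h ?k, z ?k)" by (simp add: hv)
    have "(t + h ?k, z ?k) \<in> {0..T} \<times> X" using t h0[of ?k] hT[of ?k] z[of ?k] by auto
    then have "ereal (Vs (t + h ?k, z ?k)) \<le> ereal (Vs (t, \<xi>) + h ?k ^ 2 - h ?k)"
      using z[of ?k] by (simp only: Vs)
    then have "Vs ((t, \<xi>) + h ?k *\<^sub>R (1, v ?k)) - Vs (t, \<xi>) \<le> h ?k * h ?k - h ?k"
      unfolding eq by (simp add: power2_eq_square)
    also have "\<dots> \<le> (- 1 + d) * h ?k"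
      using n h0[of ?k] mult_right_mono[of "h ?k" d "h ?k"] by (simp add: algebra_simps)
    finally have "Vs ((t, \<xi>) + h ?k *\<^sub>R (1, v ?k)) - Vs (t, \<xi>) \<le> (- 1 + d) * h ?k" .
    moreover have "norm ((1, v ?k) - (1, f (t, \<xi>, w))) < d"
      using n w(2) by (simp add: norm_Pair)
    ultimately show "\<exists>h v'. 0 < h \<and> h < d \<and> norm (v' - (1, f (t, \<xi>, w))) < d \<and>
       Vs ((t, \<xi>) + h *\<^sub>R v') - Vs (t, \<xi>) \<le> (- 1 + d) * h"
      using h0[of ?k] n by blast
  qed
qed

section \<open>The closed loop\<close>

lemma target_time_in_horizon:
  assumes "T \<ge> 0"
  shows "target_time X K T x \<in> {0..T}"
proof -
  let ?S = "{t\<in>{0..T}. x ` {0..t} \<subseteq> X - K}"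
  show ?thesis
  proof (cases "?S = {}")
    case False
    then obtain t where "t \<in> ?S" by blast
    moreover have "bdd_above ?S" by (rule bdd_aboveI[of _ T]) auto
    ultimately have "t \<le> Sup ?S" by (intro cSup_upper)
    moreover have "Sup ?S \<le> T" using False by (intro cSup_least) auto
    ultimately show ?thesis using \<open>t \<in> ?S\<close> False by (simp add: target_time_def Let_def)
  qed (use assms in \<open>simp add: target_time_def\<close>)
qed

lemma before_target_time:
  assumes "0 \<le> s" "s < target_time X K T x"
  shows "x s \<in> X - K"
proof -
  let ?S = "{t\<in>{0..T}. x ` {0..t} \<subseteq> X - K}"
  \<comment> \<open>The default value 0 for an empty set is incompatible with
    \<open>0 \<le> s\<close> and the strict bound on \<open>s\<close>.\<close>
  have "?S \<noteq> {}"
  proof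
    assume "?S = {}"
    then have "target_time X K T x = 0" unfolding target_time_def by simp
    then show False using assms by simp
  qed
  moreover have "s < Sup ?S"
    using assms(2) unfolding target_time_def Let_def if_not_P[OF \<open>?S \<noteq> {}\<close>] .
  ultimately obtain t where "t \<in> ?S" "s < t" using less_cSupE by blast
  moreover from this have "x s \<in> x ` {0..t}" using assms(1) by auto
  ultimately show ?thesis by blast
qed

text \<open>If the state at this time avoided the closed target, continuity would prolong the
  avoidance past the supremum; the strict inequality leaves room inside the horizon.\<close>

lemma target_time_hits:
  assumes "T \<ge> 0" and cont: "continuous_on {0..T} x" and X: "\<forall>t\<in>{0..T}. x t \<in> X" and K: "closed K"
    and less: "target_time X K T x < T"
  shows "x (target_time X K T x) \<in> K"
proof (rule ccontr)
  let ?S = "{t\<in>{0..T}. x ` {0..t} \<subseteq> X - K}" and ?t = "target_time X K T x"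
  assume notK: "x ?t \<notin> K"
  have t: "?t \<in> {0..T}" using target_time_in_horizon assms(1) by blast
  obtain e where "e > 0" and e: "ball (x ?t) e \<subseteq> - K"
    using openE[of "- K" "x ?t"] K notK by auto
  obtain d where "d > 0" and d: "\<And>r. \<lbrakk>r \<in> {0..T}; dist r ?t < d\<rbrakk> \<Longrightarrow> dist (x r) (x ?t) < e"
    using cont t \<open>e > 0\<close> unfolding continuous_on_iff by metis
  define t' where "t' = min T (?t + d / 2)"
  have t': "?t < t'" "t' \<in> {0..T}" using less t \<open>d > 0\<close> by (auto simp: t'_def)
  have "x r \<in> X - K" if r: "r \<in> {0..t'}" for r
  proof (cases "r < ?t")
    case True
    then show ?thesis using before_target_time[of r X K T x] r by auto
  next
    case False
    then have "dist r ?t < d" using r \<open>d > 0\<close> by (auto simp: t'_def dist_real_def)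
    then have "x r \<in> ball (x ?t) e" using d[of r] r t' by (auto simp: dist_commute)
    then show ?thesis using e X r t' by auto
  qed
  then have "t' \<in> ?S" using t' by auto
  moreover have "bdd_above ?S" by (rule bdd_aboveI[of _ T]) auto
  ultimately have "t' \<le> Sup ?S" by (intro cSup_upper)
  \<comment> \<open>Membership of \<open>t'\<close> rules out the default branch, so the case of an
    empty set needs no separate argument.\<close>
  moreover have "Sup ?S = ?t" using \<open>t' \<in> ?S\<close> by (auto simp: target_time_def Let_def)
  ultimately show False using t' by simp
qed

section \<open>Speed bound, admissible controls and minimal times\<close>

lemma norm_le_speed_bound:
  fixes f :: "real \<times> (real^'n) \<times> (real^'m) \<Rightarrow> real^'n"
  assumes f: "Lf-lipschitz_on UNIV f" and "compact U" "compact X"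
    and "t \<in> {0..T}" "x \<in> X" "w \<in> U"
  shows "norm (f (t, x, w)) \<le> speed_bound f U X T"
proof -
  have "continuous_on ({0..T} \<times> X \<times> U) f"
    using lipschitz_on_continuous_on[OF f] continuous_on_subset by blast
  then have "compact (f ` ({0..T} \<times> X \<times> U))"
    using assms by (intro compact_continuous_image compact_Times) auto
  then obtain b where "\<forall>y\<in>f ` ({0..T} \<times> X \<times> U). norm y \<le> b"
    using compact_imp_bounded bounded_iff by blast
  then have "bdd_above ((\<lambda>p. norm (f p)) ` ({0..T} \<times> X \<times> U))" by (intro bdd_aboveI2[of _ _ b]) auto
  then show ?thesis
    unfolding speed_bound_def using assms by (intro cSUP_upper) auto
qed

text \<open>A feedback control lies in \<open>U\<close> only almost everywhere, while admissibility
  asks for it at every time. Changing the control on a null set leaves the differential equation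
  valid almost everywhere.\<close>

lemma admissible_controls_modify:
  fixes f :: "real \<times> (real^'n) \<times> (real^'m) \<Rightarrow> real^'n"
  assumes U: "compact U" "w0 \<in> U"
    and u: "u \<in> borel_measurable (lebesgue_on {t0..t1})" "AE t in lebesgue_on {t0..t1}. u t \<in> U"
    and x: "ode_solution f t0 t1 u x" "AE t in lebesgue_on {t0..t1}. x t \<in> X" "x t1 \<in> K"
  shows "(\<lambda>t. if u t \<in> U then u t else w0) \<in> admissible_controls f U X K t0 t1 (x t0)"
proof -
  let ?u = "\<lambda>t. if u t \<in> U then u t else w0"
  have "{t \<in> space (lebesgue_on {t0..t1}). u t \<in> U} \<in> sets (lebesgue_on {t0..t1})"
    using measurable_sets[OF u(1), of U] U(1)
    by (simp add: vimage_def Int_def conj_commute compact_imp_closed)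
  then have "?u \<in> borel_measurable (lebesgue_on {t0..t1})"
    using u(1) by (intro measurable_If) auto
  moreover have "?u ` {t0..t1} \<subseteq> U" using U by auto
  moreover from this have "bounded (?u ` {t0..t1})"
    using U compact_imp_bounded bounded_subset by blast
  moreover have "AE t in lebesgue_on {t0..t1}. (x has_vector_derivative f (t, x t, u t)) (at t within {t0..t1})"
    using x(1) by (simp add: ode_solution_def)
  then have "AE t in lebesgue_on {t0..t1}. (x has_vector_derivative f (t, x t, ?u t)) (at t within {t0..t1})"
    using u(2) by eventually_elim simp
  then have "ode_solution f t0 t1 ?u x" using x(1) by (simp add: ode_solution_def)
  ultimately show ?thesis
    using x(2,3) unfolding admissible_controls_def by blast
qed

lemma min_time_le:
  assumes "u \<in> admissible_controls f U X K t0 t1 \<xi>" "t1 \<in> {t0..T}"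
  shows "min_time f U X K T (t0, \<xi>) \<le> ereal (t1 - t0)"
  using assms unfolding min_time_def by (auto intro!: Inf_lower)

lemma le_min_timeI:
  assumes "\<And>t1 u. \<lbrakk>t1 \<in> {t0..T}; u \<in> admissible_controls f U X K t0 t1 \<xi>\<rbrakk> \<Longrightarrow> m \<le> ereal (t1 - t0)"
  shows "m \<le> min_time f U X K T (t0, \<xi>)"
  using assms unfolding min_time_def by (auto intro!: Inf_greatest)

text \<open>End times beyond \<open>T\<close> cost more than any end time up to \<open>T\<close>,
  and at least one of the latter is available.\<close>

lemma min_time_horizon_indep:
  assumes ne: "\<exists>t1\<in>{t0..T}. admissible_controls f U X K t0 t1 \<xi> \<noteq> {}" and "T \<le> Ts"
  shows "min_time f U X K Ts (t0, \<xi>) = min_time f U X K T (t0, \<xi>)"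
proof (rule antisym)
  show "min_time f U X K Ts (t0, \<xi>) \<le> min_time f U X K T (t0, \<xi>)"
    using \<open>T \<le> Ts\<close> by (intro le_min_timeI min_time_le) auto
  obtain s v where s: "s \<in> {t0..T}" "v \<in> admissible_controls f U X K t0 s \<xi>" using ne by blast
  show "min_time f U X K T (t0, \<xi>) \<le> min_time f U X K Ts (t0, \<xi>)"
  proof (rule le_min_timeI)
    fix t1 u assume t1: "t1 \<in> {t0..Ts}" "u \<in> admissible_controls f U X K t0 t1 \<xi>"
    show "min_time f U X K T (t0, \<xi>) \<le> ereal (t1 - t0)"
    proof (cases "t1 \<le> T")
      case True
      then show ?thesis using t1 by (intro min_time_le) auto
    next
      case False
      have "min_time f U X K T (t0, \<xi>) \<le> ereal (s - t0)" using s by (intro min_time_le)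
      also have "\<dots> \<le> ereal (t1 - t0)" using s False by simp
      finally show ?thesis .
    qed
  qed
qed

text \<open>Three slopes are compared in turn: the subgradient \<open>g'\<close> realising Clarke's
  derivative, the gradient \<open>DV\<close>, and the descent subgradient \<open>g\<close>. Each
  passage to or from \<open>DV\<close> costs \<open>(1 + Cf)\<close> times the gradient
  distance.\<close>

lemma feedback_clarke_dderiv_le:
  fixes f :: "real \<times> (real^'n) \<times> (real^'m) \<Rightarrow> real^'n"
  assumes f: "Lf-lipschitz_on UNIV f" and U: "compact U" and X: "compact X" and K: "compact K"
    and t: "0 \<le> t" "t < T" and \<xi>: "\<xi> \<in> X - K"
    and conv: "convex ((\<lambda>w. f (t, \<xi>, w)) ` U)"
    and W: "L-lipschitz_on UNIV W"
    and val: "\<And>y. y \<in> {0..T} \<times> X \<Longrightarrow> ereal (W y) = min_time f U X K Ts y"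
    and DV: "continuous_on ({0..T} \<times> X) DV"
    and u: "u \<in> feedback_set f U DV t \<xi>"
  shows "clarke_dderiv W (t, \<xi>) (1, f (t, \<xi>, u))
    \<le> ereal (- 1 + 2 * (1 + speed_bound f U X T) * grad_dist ({0..T} \<times> X) DV W)"
proof -
  let ?y = "(t, \<xi>)" and ?Y = "{0..T} \<times> X"
  let ?C = "speed_bound f U X T" and ?\<Delta> = "grad_dist ?Y DV W"
  have y: "?y \<in> ?Y" using t \<xi> by auto
  have Y: "compact ?Y" using X by (intro compact_Times) auto
  obtain w where w: "w \<in> U"
    "\<And>d. d > 0 \<Longrightarrow> \<exists>h v'. 0 < h \<and> h < d \<and> norm (v' - (1, f (t, \<xi>, w))) < d \<and>
       W (?y + h *\<^sub>R v') - W ?y \<le> (- 1 + d) * h"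
    using value_descent_direction[OF f U X K t \<xi> conv val] by blast
  obtain g where g: "g \<in> clarke_subdiff W ?y" "g \<bullet> (1, f (t, \<xi>, w)) \<le> - 1"
    using clarke_subdiff_descent[OF W w(2)] by blast
  obtain g' where g': "g' \<in> clarke_subdiff W ?y"
    "clarke_dderiv W ?y (1, f (t, \<xi>, u)) = ereal (g' \<bullet> (1, f (t, \<xi>, u)))"
    using clarke_subdiff_attains[OF W] by blast
  have u: "u \<in> U" "snd (DV ?y) \<bullet> f (t, \<xi>, u) \<le> snd (DV ?y) \<bullet> f (t, \<xi>, w)"
    using u w(1) by (auto simp: feedback_set_def is_arg_min_def not_less)
  have near: "\<bar>(DV ?y - h) \<bullet> (1, f (t, \<xi>, v))\<bar> \<le> (1 + ?C) * ?\<Delta>"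
    if "h \<in> clarke_subdiff W ?y" "v \<in> U" for h v
  proof -
    have "norm (DV ?y - h) \<le> ?\<Delta>"
      by (rule norm_grad_diff_le_grad_dist[OF W Y DV y that(1)])
    moreover have "norm (1::real, f (t, \<xi>, v)) \<le> 1 + ?C"
      using norm_Pair_le[of "1::real" "f (t, \<xi>, v)"] norm_le_speed_bound[OF f U X, of t T \<xi> v] that t \<xi> by auto
    ultimately have "norm (DV ?y - h) * norm (1::real, f (t, \<xi>, v)) \<le> ?\<Delta> * (1 + ?C)"
      by (intro mult_mono) (auto intro: order_trans[OF norm_ge_zero])
    then show ?thesis using Cauchy_Schwarz_ineq2[of "DV ?y - h" "(1, f (t, \<xi>, v))"]
      by (simp only: mult.commute[of ?\<Delta>])
  qed
  \<comment> \<open>The time component is the same for \<open>u\<close> and \<open>w\<close>, so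
    minimality of the spatial part alone orders the two full slopes.\<close>
  have pair: "DV ?y \<bullet> (1, v) = fst (DV ?y) + snd (DV ?y) \<bullet> v" for v
    by (simp add: inner_prod_def)
  have "g' \<bullet> (1, f (t, \<xi>, u)) \<le> DV ?y \<bullet> (1, f (t, \<xi>, u)) + (1 + ?C) * ?\<Delta>"
    using near[OF g'(1) u(1)] unfolding inner_diff_left by linarith
  also have "DV ?y \<bullet> (1, f (t, \<xi>, u)) \<le> DV ?y \<bullet> (1, f (t, \<xi>, w))"
    using u(2) unfolding pair by simp
  also have "DV ?y \<bullet> (1, f (t, \<xi>, w)) \<le> g \<bullet> (1, f (t, \<xi>, w)) + (1 + ?C) * ?\<Delta>"
    using near[OF g(1) w(1)] unfolding inner_diff_left by linarith
  finally have "g' \<bullet> (1, f (t, \<xi>, u)) \<le> - 1 + 2 * (1 + ?C) * ?\<Delta>"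
    using g(2) by linarith
  then show ?thesis using g'(2) by simp
qed

theorem theorem4p3:
  fixes f :: "real \<times> (real^'n) \<times> (real^'m) \<Rightarrow> real^'n"
    and U :: "(real^'m) set"
    and X K :: "(real^'n) set"
    and x0 :: "real^'n"
    and T Ts :: real
    and Vs :: "real \<times> (real^'n) \<Rightarrow> real"
    and V :: "real \<times> (real^'n) \<Rightarrow> real"
    and DV :: "real \<times> (real^'n) \<Rightarrow> real \<times> (real^'n)"
    and xV :: "real \<Rightarrow> real^'n"
    and uV :: "real \<Rightarrow> real^'m"
  assumes "T > 0"
    and f_lipschitz: "\<exists>L. L-lipschitz_on UNIV f"
    and "compact U" and "U \<noteq> {}"
    and "compact X" and "compact K" and "K \<subseteq> X" and "x0 \<in> X"
    and A1: "\<And>t x. t \<in> {0..T} \<Longrightarrow> x \<in> X \<Longrightarrow> convex ((\<lambda>u. f (t, x, u)) ` U)"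
    and A2: "\<exists>t1\<in>{0..T}. admissible_controls f U X K 0 t1 x0 \<noteq> {}"
    and A3_horizon: "Ts \<ge> T"
    and A3_finite: "\<And>y. y \<in> {0..T} \<times> X \<Longrightarrow> \<bar>min_time f U X K Ts y\<bar> \<noteq> \<infinity>"
    and A3_lipschitz:
      "\<exists>L. L-lipschitz_on ({0..T} \<times> X) (\<lambda>y. real_of_ereal (min_time f U X K Ts y))"
    and Vs_lipschitz: "\<exists>L. L-lipschitz_on UNIV Vs"
    and Vs_extends: "\<And>y. y \<in> {0..T} \<times> X \<Longrightarrow> ereal (Vs y) = min_time f U X K Ts y"
    and V_grad: "\<And>y. GDERIV V y :> DV y"
    and V_C1: "continuous_on UNIV DV"
    and traj: "closed_loop_trajectory f U X DV T x0 xV uV"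
  defines "tV \<equiv> target_time X K T xV"
    and "\<tau> \<equiv> real_of_ereal (min_time f U X K T (0, x0))"
    and "Cf \<equiv> speed_bound f U X T"
    and "\<Delta> \<equiv> grad_dist ({0..T} \<times> X) DV Vs"
  shows "(\<forall>t\<in>{0..tV}.
            min_time f U X K Ts (t, xV t) \<le> ereal ((\<tau> - t) + t * (2 * (1 + Cf) * \<Delta>))) \<and>
         min_time f U X K T (0, x0) = ereal \<tau> \<and>
         min_time f U X K Ts (0, x0) = ereal \<tau> \<and>
         \<tau> \<le> tV \<and>
         min_time f U X K Ts (\<tau>, xV \<tau>) \<le> ereal (2 * \<tau> * (1 + Cf) * \<Delta>)"
proof -
  obtain Lf where f: "Lf-lipschitz_on UNIV f" using f_lipschitz by blast
  obtain L where W: "L-lipschitz_on UNIV Vs" using Vs_lipschitz by blast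
  have uV: "uV \<in> borel_measurable (lebesgue_on {0..T})" and sol: "ode_solution f 0 T uV xV"
    and start: "xV 0 = x0" and fb: "AE t in lebesgue_on {0..T}. uV t \<in> feedback_set f U DV t (xV t)"
    and inX: "\<forall>t\<in>{0..T}. xV t \<in> X"
    using traj by (auto simp: closed_loop_trajectory_def)
  have ac: "abs_continuous_on 0 T xV"
    and ode: "AE t in lebesgue_on {0..T}. (xV has_vector_derivative f (t, xV t, uV t)) (at t within {0..T})"
    using sol by (auto simp: ode_solution_def)
  have tV: "tV \<in> {0..T}" unfolding tV_def using \<open>T > 0\<close> by (intro target_time_in_horizon) simp

  \<comment> \<open>The initial value and its comparison with \<open>tV\<close>\<close>
  have horizon: "min_time f U X K Ts (0, x0) = min_time f U X K T (0, x0)"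
    by (rule min_time_horizon_indep[OF A2 A3_horizon])
  then have eq_\<tau>: "min_time f U X K T (0, x0) = ereal \<tau>" "min_time f U X K Ts (0, x0) = ereal \<tau>"
    using A3_finite[of "(0, x0)"] \<open>T > 0\<close> \<open>x0 \<in> X\<close> by (auto simp: \<tau>_def ereal_real)
  have "\<tau> \<ge> 0"
  proof -
    have "ereal 0 \<le> min_time f U X K T (0, x0)" by (rule le_min_timeI) auto
    then show ?thesis by (simp add: eq_\<tau>)
  qed
  have "\<tau> \<le> tV"
  proof (cases "tV < T")
    case True
    \<comment> \<open>The closed loop then reaches the target at \<open>tV\<close>, so its control,
      corrected on a null set, is a competitor of cost \<open>tV\<close>.\<close>
    have hit: "xV tV \<in> K"
      using True \<open>T > 0\<close> inX \<open>compact K\<close> unfolding tV_def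
      by (intro target_time_hits abs_continuous_on_imp_continuous_on[OF ac]) (auto simp: compact_imp_closed)
    obtain w0 where "w0 \<in> U" using \<open>U \<noteq> {}\<close> by blast
    have sub: "{0..tV} \<subseteq> {0..T}" using tV by auto
    have "AE t in lebesgue_on {0..tV}. uV t \<in> U"
      by (rule AE_lebesgue_on_subset[OF fb sub]) (auto simp: feedback_set_def is_arg_min_def)
    moreover have "AE t in lebesgue_on {0..tV}. xV t \<in> X"
      using inX sub by (intro AE_I2) auto
    ultimately have "(\<lambda>t. if uV t \<in> U then uV t else w0) \<in> admissible_controls f U X K 0 tV (xV 0)"
      using \<open>compact U\<close> \<open>w0 \<in> U\<close> measurable_restrict_mono[OF uV sub] ode_solution_subset[OF sol] tV hit
      by (intro admissible_controls_modify) auto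
    from min_time_le[OF this tV] show ?thesis by (simp add: start eq_\<tau>)
  next
    case False
    \<comment> \<open>Here \<open>tV = T\<close>, and any admissible end time within the horizon
      bounds \<open>\<tau>\<close> by \<open>T\<close>.\<close>
    obtain t1 u where t1: "t1 \<in> {0..T}" "u \<in> admissible_controls f U X K 0 t1 x0" using A2 by blast
    from min_time_le[OF t1(2,1)] show ?thesis using False t1 by (simp add: eq_\<tau>)
  qed

  \<comment> \<open>Growth of the value function along the closed loop\<close>
  have bound: "min_time f U X K Ts (t, xV t) \<le> ereal ((\<tau> - t) + t * (2 * (1 + Cf) * \<Delta>))"
    if t: "t \<in> {0..tV}" for t
  proof -
    let ?c = "- 1 + 2 * (1 + Cf) * \<Delta>"
    have sub: "{0..t} \<subseteq> {0..T}" using t tV by auto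
    \<comment> \<open>Discarding the endpoint yields \<open>s < tV\<close> and \<open>s < T\<close>:
      at \<open>tV\<close> the state may already be in the target, and the descent direction needs
      room before \<open>T\<close>.\<close>
    have "AE s in lebesgue_on {0..T}. s \<noteq> t"
      by (auto simp: AE_lebesgue_on_iff_negligible intro!: negligible_subset[OF negligible_sing[of t]])
    with ode fb have "AE s in lebesgue_on {0..T}. (xV has_vector_derivative f (s, xV s, uV s)) (at s within {0..T}) \<and>
        uV s \<in> feedback_set f U DV s (xV s) \<and> s \<noteq> t"
      by eventually_elim simp
    then have "AE s in lebesgue_on {0..t}. \<exists>D. (xV has_vector_derivative D) (at s within {0..t}) \<and>
        clarke_dderiv Vs (s, xV s) (1, D) \<le> ereal ?c"
    proof (rule AE_lebesgue_on_subset[OF _ sub])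
      fix s assume s: "s \<in> {0..t}" "(xV has_vector_derivative f (s, xV s, uV s)) (at s within {0..T}) \<and>
        uV s \<in> feedback_set f U DV s (xV s) \<and> s \<noteq> t"
      then have st: "0 \<le> s" "s < T" "s < tV" using t tV by auto
      have "xV s \<in> X - K" using st unfolding tV_def by (intro before_target_time) auto
      moreover from this have "convex ((\<lambda>w. f (s, xV s, w)) ` U)" using st by (intro A1) auto
      moreover have "continuous_on ({0..T} \<times> X) DV" using V_C1 continuous_on_subset by blast
      ultimately have "clarke_dderiv Vs (s, xV s) (1, f (s, xV s, uV s)) \<le> ereal ?c"
        unfolding Cf_def \<Delta>_def using s st f W Vs_extends \<open>compact U\<close> \<open>compact X\<close> \<open>compact K\<close>
        by (intro feedback_clarke_dderiv_le) auto
      moreover have "(xV has_vector_derivative f (s, xV s, uV s)) (at s within {0..t})"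
        using s sub has_vector_derivative_within_subset by blast
      ultimately show "\<exists>D. (xV has_vector_derivative D) (at s within {0..t}) \<and>
        clarke_dderiv Vs (s, xV s) (1, D) \<le> ereal ?c" by blast
    qed auto
    moreover have "abs_continuous_on 0 t xV"
      using abs_continuous_on_subset[OF ac, of 0 t] t tV by simp
    ultimately have "Vs (t, xV t) - Vs (0, xV 0) \<le> ?c * (t - 0)"
      using t by (intro clarke_dderiv_growth[OF W]) auto
    moreover have "Vs (0, x0) = \<tau>"
      using Vs_extends[of "(0, x0)"] eq_\<tau> \<open>T > 0\<close> \<open>x0 \<in> X\<close> by simp
    ultimately have "Vs (t, xV t) \<le> (\<tau> - t) + t * (2 * (1 + Cf) * \<Delta>)"
      by (simp add: start algebra_simps)
    moreover have "ereal (Vs (t, xV t)) = min_time f U X K Ts (t, xV t)"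
      using t tV inX by (intro Vs_extends) auto
    ultimately show ?thesis by (metis ereal_less_eq(3))
  qed
  \<comment> \<open>At \<open>t = \<tau>\<close> the summand \<open>\<tau> - t\<close> vanishes;
    \<open>\<tau> \<le> tV\<close> permits this choice.\<close>
  moreover have "min_time f U X K Ts (\<tau>, xV \<tau>) \<le> ereal (2 * \<tau> * (1 + Cf) * \<Delta>)"
    using bound[of \<tau>] \<open>\<tau> \<ge> 0\<close> \<open>\<tau> \<le> tV\<close> by (simp add: mult_ac)
  ultimately show ?thesis using eq_\<tau> \<open>\<tau> \<le> tV\<close> by blast
qed

end
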